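(* Let $1\le p_1<\dots<p_n<\infty$ and $p\in[1,\infty)\setminus\{p_1,\dots,p_n\}$. Then neither $T^p$ nor $\ell_p$ coarse Lipschitz embeds into $T^{p_1}\oplus\dots\oplus T^{p_n}$. In particular, $T^p$ does not coarse Lipschitz embed into $T^q$ for all $p,q\in[1,\infty)$ with $p\ne q$.
   Context: $c_{00}$ is the space of eventually zero real sequences, $\|x\|_0=\max|x_n|$; for finite $E\subset\mathbb N$, $Ex$ is the restriction of $x$ to $E$; $E<F$ means $\max E<\min F$, $k\le E$ means $k\le\min E$. The Tsirelson space $T$ is the completion of $c_{00}$ under the unique norm with $\|x\|=\max\{\|x\|_0,\frac12\sup\sum_{j=1}^k\|E_jx\|\}$, sup over $k$ and finite sets $k\le E_1<\dots<E_k$. For $p\in[1,\infty)$, $T^p$ (the $p$-convexification) is the space of real sequences $(x_n)$ with $\sum|x_n|^pe_n\in T$, with norm $\|x\|_p=\|\sum|x_n|^pe_n\|_T^{1/p}$. A map $f$ between metric spaces is a coarse Lipschitz embedding if for some $L>0$, $\omega_f(t)\le Lt+L$ and $\rho_f(t)\ge L^{-1}t-L$ for all $t\ge0$, where $\omega_f(t)=\sup\{d(f(x),f(y)):d(x,y)\le t\}$, $\rho_f(t)=\inf\{d(f(x),f(y)):d(x,y)\ge t\}$. Finite direct sums carry any of the equivalent product norms. *)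

theory Defs
  imports "HOL-Analysis.Analysis"
begin

text \<open>Real sequences are functions nat => real; coordinate i (0-based) plays
the role of the natural number i+1 of the paper (N = {1,2,...}).\<close>

definition c00 :: "(nat \<Rightarrow> real) set" where
  "c00 = {x. finite {i. x i \<noteq> 0}}"

definition restr :: "nat set \<Rightarrow> (nat \<Rightarrow> real) \<Rightarrow> (nat \<Rightarrow> real)" where
  "restr E x = (\<lambda>i. if i \<in> E then x i else 0)"

definition supnorm0 :: "(nat \<Rightarrow> real) \<Rightarrow> real" where
  "supnorm0 x = Sup (range (\<lambda>i. \<bar>x i\<bar>))"

text \<open>Admissible families k <= E_1 < ... < E_k of finite nonempty sets
(indexed E 0, ..., E (k-1)); "k <= E_1" refers to 1-based positions.\<close>

definition admissible :: "nat \<Rightarrow> (nat \<Rightarrow> nat set) \<Rightarrow> bool" where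
  "admissible k E \<longleftrightarrow> 1 \<le> k \<and>
     (\<forall>j<k. finite (E j) \<and> E j \<noteq> {}) \<and>
     (\<forall>j. Suc j < k \<longrightarrow> Max (E j) < Min (E (Suc j))) \<and>
     k \<le> Suc (Min (E 0))"

definition is_norm_on_c00 :: "((nat \<Rightarrow> real) \<Rightarrow> real) \<Rightarrow> bool" where
  "is_norm_on_c00 f \<longleftrightarrow>
     (\<forall>x\<in>c00. f x \<ge> 0 \<and> (f x = 0 \<longleftrightarrow> x = (\<lambda>_. 0))) \<and>
     (\<forall>x\<in>c00. \<forall>c. f (\<lambda>i. c * x i) = \<bar>c\<bar> * f x) \<and>
     (\<forall>x\<in>c00. \<forall>y\<in>c00. f (\<lambda>i. x i + y i) \<le> f x + f y)"

definition tsirelson_eq :: "((nat \<Rightarrow> real) \<Rightarrow> real) \<Rightarrow> bool" where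
  "tsirelson_eq f \<longleftrightarrow> (\<forall>x\<in>c00. f x = max (supnorm0 x)
      ((1/2) * Sup {\<Sum>j<k. f (restr (E j) x) | k E. admissible k E}))"

text \<open>The Tsirelson norm on c00: the unique norm satisfying the implicit equation
(set to 0 off c00 to make it unique as a function).\<close>

definition tsirelson_norm :: "(nat \<Rightarrow> real) \<Rightarrow> real" where
  "tsirelson_norm = (THE f. is_norm_on_c00 f \<and> tsirelson_eq f \<and> (\<forall>x. x \<notin> c00 \<longrightarrow> f x = 0))"

section \<open>The Tsirelson space T as a sequence space (completion of c00)\<close>

definition trunc :: "nat \<Rightarrow> (nat \<Rightarrow> real) \<Rightarrow> (nat \<Rightarrow> real)" where
  "trunc m x = restr {..<m} x"

definition T_space :: "(nat \<Rightarrow> real) set" where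
  "T_space = {x. \<forall>\<epsilon>>0. \<exists>N. \<forall>m\<ge>N. \<forall>n\<ge>N.
      tsirelson_norm (\<lambda>i. trunc n x i - trunc m x i) < \<epsilon>}"

definition T_norm :: "(nat \<Rightarrow> real) \<Rightarrow> real" where
  "T_norm x = lim (\<lambda>m. tsirelson_norm (trunc m x))"

definition Tp :: "real \<Rightarrow> (nat \<Rightarrow> real) set" where
  "Tp p = {x. (\<lambda>i. \<bar>x i\<bar> powr p) \<in> T_space}"

definition Tp_norm :: "real \<Rightarrow> (nat \<Rightarrow> real) \<Rightarrow> real" where
  "Tp_norm p x = T_norm (\<lambda>i. \<bar>x i\<bar> powr p) powr (1/p)"

definition Tp_dist :: "real \<Rightarrow> (nat \<Rightarrow> real) \<Rightarrow> (nat \<Rightarrow> real) \<Rightarrow> real" where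
  "Tp_dist p x y = Tp_norm p (\<lambda>i. x i - y i)"

definition lp :: "real \<Rightarrow> (nat \<Rightarrow> real) set" where
  "lp p = {x. summable (\<lambda>i. \<bar>x i\<bar> powr p)}"

definition lp_dist :: "real \<Rightarrow> (nat \<Rightarrow> real) \<Rightarrow> (nat \<Rightarrow> real) \<Rightarrow> real" where
  "lp_dist p x y = (\<Sum>i. \<bar>x i - y i\<bar> powr p) powr (1/p)"

definition dsum :: "nat \<Rightarrow> (nat \<Rightarrow> real) \<Rightarrow> (nat \<Rightarrow> nat \<Rightarrow> real) set" where
  "dsum n ps = {x. (\<forall>i<n. x i \<in> Tp (ps i)) \<and> (\<forall>i\<ge>n. x i = (\<lambda>_. 0))}"

definition dsum_dist :: "nat \<Rightarrow> (nat \<Rightarrow> real) \<Rightarrow> (nat \<Rightarrow> nat \<Rightarrow> real) \<Rightarrow> (nat \<Rightarrow> nat \<Rightarrow> real) \<Rightarrow> real" where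
  "dsum_dist n ps x y = (\<Sum>i<n. Tp_dist (ps i) (x i) (y i))"

text \<open>omega_f(t) <= L t + L and rho_f(t) >= t/L - L for all t >= 0, with the
sup/inf unfolded.\<close>

definition coarse_lipschitz_embeds ::
  "'a set \<Rightarrow> ('a \<Rightarrow> 'a \<Rightarrow> real) \<Rightarrow> 'b set \<Rightarrow> ('b \<Rightarrow> 'b \<Rightarrow> real) \<Rightarrow> bool" where
  "coarse_lipschitz_embeds A dA B dB \<longleftrightarrow> (\<exists>f L. f ` A \<subseteq> B \<and> L > 0 \<and>
     (\<forall>t\<ge>0. \<forall>x\<in>A. \<forall>y\<in>A. dA x y \<le> t \<longrightarrow> dB (f x) (f y) \<le> L * t + L) \<and>
     (\<forall>t\<ge>0. \<forall>x\<in>A. \<forall>y\<in>A. dA x y \<ge> t \<longrightarrow> dB (f x) (f y) \<ge> t / L - L))"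

end

theory Submission
  imports Defs
begin

text \<open>
  Both \<open>\<ell>\<^sub>p\<close> and \<open>T\<^sup>p\<close> are normed by \<open>\<parallel>x\<parallel> = sup (\<Sum>i<M. \<phi> i * \<bar>x i\<bar> powr p) powr (1/p)\<close>, where \<open>\<phi>\<close> runs
  through a set \<open>K\<close> of weights with values in \<open>[0, 1]\<close>: the constant 1 for \<open>\<ell>\<^sub>p\<close>, the norming functionals of
  \<open>T\<close> for \<open>T\<^sup>p\<close>. In both cases \<open>K\<close> is stable under half sums over admissible families.

  Suppose \<open>f\<close> is a coarse Lipschitz embedding of such a space with exponent \<open>p\<close> into the direct sum, and
  consider the points \<open>x + \<tau> * k powr (-1/p) * (e n\<^sub>1 + \<dots> + e n\<^sub>k)\<close>, whose mutual distances are of order \<open>\<tau>\<close>.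

  In the components with \<open>p\<^sub>i > p\<close>, disjointly supported vectors satisfy an upper \<open>p\<^sub>i\<close>-estimate. Taking
  limits of the coordinates along an ultrafilter in \<open>n\<^sub>k\<close>, \<dots>, \<open>n\<^sub>1\<close> one after the other (as in the graph
  argument of Kalton and Randrianarivony), most image points lie within a multiple of
  \<open>k powr (1/p\<^sub>i - 1/p) * \<tau>\<close> of one point, which is negligible against \<open>\<tau>\<close> for large \<open>k\<close>.

  In the components with \<open>p\<^sub>i < p\<close>, any \<open>N\<close> successive blocks of modulus at least \<open>a\<close> have a sum of modulus at
  least \<open>N * a / 4\<close>. This weak-type inequality yields an equivalent norm \<open>\<rho>\<close> with
  \<open>\<rho>(u + v) powr q \<ge> \<rho>(u) powr q + \<rho>(v) powr q\<close> for successive \<open>u\<close>, \<open>v\<close>, where \<open>p\<^sub>i < q < p\<close>. If \<open>x\<close> is the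
  midpoint of a pair at which the asymptotic Lipschitz constant of \<open>f\<close> is nearly attained, the points above
  are approximate midpoints. In the target, approximate midpoints lie near a finite-dimensional set up
  to an error small compared to \<open>\<tau>\<close>, because \<open>q < p\<close>. So these components collapse as well, and the
  lower bound for \<open>f\<close> is violated.
\<close>

section \<open>Weighted sequence spaces\<close>

definition wsum :: "(nat \<Rightarrow> real) \<Rightarrow> real \<Rightarrow> nat \<Rightarrow> (nat \<Rightarrow> real) \<Rightarrow> real" where
  "wsum \<phi> p M x = (\<Sum>i<M. \<phi> i * \<bar>x i\<bar> powr p)"

definition wspace :: "(nat \<Rightarrow> real) set \<Rightarrow> real \<Rightarrow> (nat \<Rightarrow> real) set" where
  "wspace K p = {x. \<exists>A. \<forall>\<phi>\<in>K. \<forall>M. wsum \<phi> p M x \<le> A}"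

text \<open>Using finite sums of every length \<open>M\<close> avoids all convergence questions.
  Outside \<open>wspace K p\<close> this is the supremum of an unbounded set and carries no
  information.\<close>

definition wmod :: "(nat \<Rightarrow> real) set \<Rightarrow> real \<Rightarrow> (nat \<Rightarrow> real) \<Rightarrow> real" where
  "wmod K p x = (SUP (\<phi>, M)\<in>K \<times> UNIV. wsum \<phi> p M x)"

definition wnorm :: "(nat \<Rightarrow> real) set \<Rightarrow> real \<Rightarrow> (nat \<Rightarrow> real) \<Rightarrow> real" where
  "wnorm K p x = wmod K p x powr (1 / p)"

definition wdist :: "(nat \<Rightarrow> real) set \<Rightarrow> real \<Rightarrow> (nat \<Rightarrow> real) \<Rightarrow> (nat \<Rightarrow> real) \<Rightarrow> real" where
  "wdist K p x y = wnorm K p (\<lambda>i. x i - y i)"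

section \<open>Elementary inequalities for real powers\<close>

lemma powr_le_powr_imp_le:
  fixes a b p :: real
  assumes "a powr p \<le> b powr p" "0 < p" "0 \<le> b"
  shows "a \<le> b"
  using assms powr_less_mono2[of p b a] by (meson not_le)

text \<open>Convexity of the \<open>q\<close>-th power with weights \<open>A / (A + B)\<close> and
  \<open>B / (A + B)\<close>. If \<open>A\<close> and \<open>B\<close> bound two norms, summing the
  right side gives at most \<open>(A + B) powr q\<close>, which is how the triangle inequalities
  below arise.\<close>

lemma powr_add_le_convex:
  fixes x y A B q :: real
  assumes "0 \<le> x" "0 \<le> y" "0 < A" "0 < B" "1 \<le> q"
  shows "(x + y) powr q \<le> (A + B) powr q * (A / (A + B) * (x / A) powr q + B / (A + B) * (y / B) powr q)"
proof -
  have aux: "(t * z) powr q \<le> t * z powr q" if "0 \<le> t" "t \<le> 1" "0 \<le> z" for t z :: real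
  proof -
    have "t powr q \<le> t"
      using powr_mono'[of 1 q t] that assms by (cases "t = 0") auto
    then show ?thesis
      using that by (simp add: powr_mult mult_right_mono)
  qed
  define t where "t = B / (A + B)"
  have t: "0 < t" "t < 1" and t1: "1 - t = A / (A + B)"
    using assms by (auto simp: t_def field_simps)
  have conv: "((1 - t) * a + t * b) powr q \<le> (1 - t) * a powr q + t * b powr q"
    if ab: "0 \<le> a" "0 \<le> b" for a b :: real
  \<comment> \<open>Convexity is applied at positive arguments; when one of them vanishes,
    \<open>aux\<close> bounds the other term.\<close>
  proof (cases "a = 0 \<or> b = 0")
    case True
    then show ?thesis using aux[of t b] aux[of "1 - t" a] ab t assms by auto
  next
    case False
    then show ?thesis
      using convex_onD[OF powr_convex[OF assms(5)], of t a b] ab t by auto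
  qed
  have "x + y = (A + B) * ((1 - t) * (x / A) + t * (y / B))"
    unfolding t1 unfolding t_def using assms by (simp add: distrib_left)
  then have "(x + y) powr q = (A + B) powr q * ((1 - t) * (x / A) + t * (y / B)) powr q"
    using assms t by (simp add: powr_mult)
  also have "\<dots> \<le> (A + B) powr q * ((1 - t) * (x / A) powr q + t * (y / B) powr q)"
    by (intro mult_left_mono conv) (use assms in auto)
  finally show ?thesis unfolding t1 unfolding t_def .
qed

text \<open>\<open>K_admissible\<close> asks only that some member dominates the half sum. In this
  form it holds both for the norming set of \<open>T\<close> and for the single constant weight of
  \<open>\<ell>\<^sub>p\<close>, although the half sums of the latter are not constant.\<close>

locale tsirelson_weights =
  fixes K :: "(nat \<Rightarrow> real) set"
  assumes K_nonneg: "\<phi> \<in> K \<Longrightarrow> 0 \<le> \<phi> i"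
    and K_le_one: "\<phi> \<in> K \<Longrightarrow> \<phi> i \<le> 1"
    and K_unit: "\<exists>\<phi>\<in>K. \<phi> i = 1"
    and K_admissible: "admissible k E \<Longrightarrow> (\<And>j. j < k \<Longrightarrow> \<phi>s j \<in> K) \<Longrightarrow>
      \<exists>\<psi>\<in>K. \<forall>i. (1/2) * (\<Sum>j<k. if i \<in> E j then \<phi>s j i else 0) \<le> \<psi> i"
begin

lemma K_nonempty: "K \<noteq> {}"
  using K_unit by blast

lemma wsum_nonneg: "\<phi> \<in> K \<Longrightarrow> 0 \<le> wsum \<phi> p M x"
  unfolding wsum_def by (intro sum_nonneg) (simp add: K_nonneg)

lemma wsum_le_wmod:
  assumes "x \<in> wspace K p" "\<phi> \<in> K"
  shows "wsum \<phi> p M x \<le> wmod K p x"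
proof -
  obtain A where "\<forall>\<phi>\<in>K. \<forall>M. wsum \<phi> p M x \<le> A"
    using assms by (auto simp: wspace_def)
  then have "bdd_above ((\<lambda>(\<phi>, M). wsum \<phi> p M x) ` (K \<times> UNIV))"
    by (auto intro!: bdd_aboveI[of _ A])
  from cSUP_upper[OF _ this, of "(\<phi>, M)"] show ?thesis
    using assms by (simp add: wmod_def)
qed

lemma wmod_least:
  assumes "\<And>\<phi> M. \<phi> \<in> K \<Longrightarrow> wsum \<phi> p M x \<le> A"
  shows "wmod K p x \<le> A"
  unfolding wmod_def by (rule cSUP_least) (use assms K_nonempty in auto)

lemma wspaceI: "(\<And>\<phi> M. \<phi> \<in> K \<Longrightarrow> wsum \<phi> p M x \<le> A) \<Longrightarrow> x \<in> wspace K p"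
  by (auto simp: wspace_def)

lemma wmod_nonneg: "x \<in> wspace K p \<Longrightarrow> 0 \<le> wmod K p x"
  using wsum_le_wmod wsum_nonneg K_nonempty by (meson all_not_in_conv order_trans)

lemma wmod_approx:
  assumes "c < wmod K p x"
  obtains \<phi> M where "\<phi> \<in> K" "c < wsum \<phi> p M x"
proof -
  have "\<exists>\<phi>\<in>K. \<exists>M. c < wsum \<phi> p M x"
  proof (rule ccontr)
    assume "\<not> ?thesis"
    then have "wmod K p x \<le> c" by (intro wmod_least) (auto simp: not_less)
    then show False using assms by simp
  qed
  then show ?thesis using that by blast
qed

section \<open>Monotonicity, homogeneity and triangle inequality of the norm\<close>

lemma wnorm_nonneg [simp]: "0 \<le> wnorm K p x"
  by (simp add: wnorm_def)

lemma wnorm_powr: "x \<in> wspace K p \<Longrightarrow> 1 \<le> p \<Longrightarrow> wnorm K p x powr p = wmod K p x"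
  using wmod_nonneg by (simp add: wnorm_def powr_powr)

lemma wnorm_leI:
  assumes "1 \<le> p" "0 \<le> A" "\<And>\<phi> M. \<phi> \<in> K \<Longrightarrow> wsum \<phi> p M x \<le> A powr p"
  shows "wnorm K p x \<le> A"
proof -
  have x: "x \<in> wspace K p" using assms(3) by (rule wspaceI)
  have "wmod K p x \<le> A powr p" using assms(3) by (rule wmod_least)
  then have "wnorm K p x powr p \<le> A powr p" using wnorm_powr[OF x assms(1)] by simp
  then show ?thesis using assms by (auto intro: powr_le_powr_imp_le)
qed

lemma wsum_le_of_wnorm_le:
  assumes "1 \<le> p" "x \<in> wspace K p" "wnorm K p x \<le> A" "\<phi> \<in> K"
  shows "wsum \<phi> p M x \<le> A powr p"
proof -
  have "wsum \<phi> p M x \<le> wnorm K p x powr p"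
    using wsum_le_wmod assms wnorm_powr by simp
  also have "\<dots> \<le> A powr p" using assms by (intro powr_mono2) auto
  finally show ?thesis .
qed

lemma wsum_mono: "\<phi> \<in> K \<Longrightarrow> 1 \<le> p \<Longrightarrow> (\<And>i. \<bar>x i\<bar> \<le> \<bar>y i\<bar>) \<Longrightarrow> wsum \<phi> p M x \<le> wsum \<phi> p M y"
  unfolding wsum_def by (intro sum_mono mult_left_mono powr_mono2) (auto simp: K_nonneg)

lemma wspace_mono:
  assumes "y \<in> wspace K p" "1 \<le> p" "\<And>i. \<bar>x i\<bar> \<le> \<bar>y i\<bar>"
  shows "x \<in> wspace K p"
  by (rule wspaceI[where A = "wmod K p y"])
    (use wsum_mono[of _ p x y] wsum_le_wmod[OF assms(1)] assms in \<open>blast intro: order_trans\<close>)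

lemma wmod_mono:
  assumes "y \<in> wspace K p" "1 \<le> p" "\<And>i. \<bar>x i\<bar> \<le> \<bar>y i\<bar>"
  shows "wmod K p x \<le> wmod K p y"
  by (rule wmod_least)
    (use wsum_mono[of _ p x y] wsum_le_wmod[OF assms(1)] assms in \<open>blast intro: order_trans\<close>)

lemma wnorm_mono:
  assumes "y \<in> wspace K p" "1 \<le> p" "\<And>i. \<bar>x i\<bar> \<le> \<bar>y i\<bar>"
  shows "wnorm K p x \<le> wnorm K p y"
  unfolding wnorm_def
  by (intro powr_mono2 wmod_mono wmod_nonneg wspace_mono[OF assms]) (use assms in auto)

lemma wspace_zero [simp]: "(\<lambda>i. 0) \<in> wspace K p"
  by (rule wspaceI[where A = 0]) (simp add: wsum_def)

lemma wmod_zero [simp]: "wmod K p (\<lambda>i. 0) = 0"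
  by (rule antisym, rule wmod_least) (auto simp: wsum_def wmod_nonneg)

lemma wnorm_zero [simp]: "wnorm K p (\<lambda>i. 0) = 0"
  by (simp add: wnorm_def)

lemma wsum_scale: "wsum \<phi> p M (\<lambda>i. c * x i) = \<bar>c\<bar> powr p * wsum \<phi> p M x"
  by (simp add: wsum_def sum_distrib_left abs_mult powr_mult mult_ac)

lemma wspace_scale:
  assumes "x \<in> wspace K p"
  shows "(\<lambda>i. c * x i) \<in> wspace K p"
  by (rule wspaceI[where A = "\<bar>c\<bar> powr p * wmod K p x"])
    (use assms in \<open>auto simp: wsum_scale intro!: mult_left_mono wsum_le_wmod\<close>)

lemma wnorm_scale_le:
  assumes "x \<in> wspace K p" "1 \<le> p"
  shows "wnorm K p (\<lambda>i. c * x i) \<le> \<bar>c\<bar> * wnorm K p x"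
  by (rule wnorm_leI)
    (use assms in \<open>auto simp: wsum_scale powr_mult intro!: mult_left_mono wsum_le_of_wnorm_le\<close>)

lemma wnorm_scale:
  assumes "x \<in> wspace K p" "1 \<le> p"
  shows "wnorm K p (\<lambda>i. c * x i) = \<bar>c\<bar> * wnorm K p x"
proof (cases "c = 0")
  case False
  \<comment> \<open>The reverse inequality is the one already proved, applied to the vector
    \<open>c * x\<close> and the scalar \<open>inverse c\<close>.\<close>
  have "wnorm K p x \<le> \<bar>inverse c\<bar> * wnorm K p (\<lambda>i. c * x i)"
    using wnorm_scale_le[OF wspace_scale[OF assms(1), of c] assms(2), of "inverse c"] False
    by (simp flip: mult.assoc)
  then have "\<bar>c\<bar> * wnorm K p x \<le> wnorm K p (\<lambda>i. c * x i)"
    using False by (simp add: field_simps abs_inverse)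
  then show ?thesis using wnorm_scale_le[OF assms, of c] by linarith
qed simp

lemma wnorm_uminus: "wnorm K p (\<lambda>i. - x i) = wnorm K p x"
  by (simp add: wnorm_def wmod_def wsum_def)

text \<open>Minkowski's inequality for one weight: \<open>powr_add_le_convex\<close> is applied at
  each coordinate and summed. Strictly positive bounds \<open>A\<close> and \<open>B\<close> keep
  the quotients meaningful; \<open>wnorm_triangle\<close> lets them tend to the norms.\<close>

lemma wsum_add_le:
  assumes "1 \<le> p" "x \<in> wspace K p" "y \<in> wspace K p" "\<phi> \<in> K"
    and "wnorm K p x \<le> A" "wnorm K p y \<le> B" "0 < A" "0 < B"
  shows "wsum \<phi> p M (\<lambda>i. x i + y i) \<le> (A + B) powr p"
proof -
  have "\<bar>x i + y i\<bar> powr p \<le> (\<bar>x i\<bar> + \<bar>y i\<bar>) powr p" for i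
    using assms by (intro powr_mono2) auto
  also have "(\<bar>x i\<bar> + \<bar>y i\<bar>) powr p \<le>
      (A + B) powr p * (A / (A + B) * (\<bar>x i\<bar> / A) powr p + B / (A + B) * (\<bar>y i\<bar> / B) powr p)" for i
    using assms by (intro powr_add_le_convex) auto
  finally have *: "\<bar>x i + y i\<bar> powr p \<le>
      (A + B) powr p * (A / (A + B) / A powr p * \<bar>x i\<bar> powr p + B / (A + B) / B powr p * \<bar>y i\<bar> powr p)" for i
    using assms by (simp add: powr_divide)
  have "wsum \<phi> p M (\<lambda>i. x i + y i) \<le> (\<Sum>i<M. \<phi> i *
      ((A + B) powr p * (A / (A + B) / A powr p * \<bar>x i\<bar> powr p + B / (A + B) / B powr p * \<bar>y i\<bar> powr p)))"
    unfolding wsum_def by (intro sum_mono mult_left_mono * K_nonneg assms)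
  also have "\<dots> = (A + B) powr p *
      (A / (A + B) / A powr p * wsum \<phi> p M x + B / (A + B) / B powr p * wsum \<phi> p M y)"
    unfolding wsum_def by (simp add: sum_distrib_left sum.distrib distrib_left mult_ac)
  also have "\<dots> \<le> (A + B) powr p *
      (A / (A + B) / A powr p * A powr p + B / (A + B) / B powr p * B powr p)"
    by (intro mult_left_mono add_mono wsum_le_of_wnorm_le) (use assms in auto)
  also have "\<dots> = (A + B) powr p" using assms by (simp flip: add_divide_distrib)
  finally show ?thesis .
qed

lemma wspace_add:
  assumes "1 \<le> p" "x \<in> wspace K p" "y \<in> wspace K p"
  shows "(\<lambda>i. x i + y i) \<in> wspace K p"
  by (rule wspaceI, rule wsum_add_le[where A = "wnorm K p x + 1" and B = "wnorm K p y + 1"])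
    (use assms in \<open>auto simp: add_nonneg_pos\<close>)

lemma wnorm_triangle:
  assumes "1 \<le> p" "x \<in> wspace K p" "y \<in> wspace K p"
  shows "wnorm K p (\<lambda>i. x i + y i) \<le> wnorm K p x + wnorm K p y"
proof (rule field_le_epsilon)
  fix e :: real assume e: "0 < e"
  have "wnorm K p (\<lambda>i. x i + y i) \<le> (wnorm K p x + e/2) + (wnorm K p y + e/2)"
    by (rule wnorm_leI, use assms e in simp, use assms e in simp, rule wsum_add_le)
      (use assms e in \<open>auto simp: add_nonneg_pos\<close>)
  then show "wnorm K p (\<lambda>i. x i + y i) \<le> wnorm K p x + wnorm K p y + e" by simp
qed

lemma wspace_uminus: "x \<in> wspace K p \<Longrightarrow> (\<lambda>i. - x i) \<in> wspace K p"
  using wspace_scale[of x p "-1"] by simp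

lemma wspace_diff:
  assumes "1 \<le> p" "x \<in> wspace K p" "y \<in> wspace K p"
  shows "(\<lambda>i. x i - y i) \<in> wspace K p"
  using wspace_add[OF assms(1,2) wspace_uminus[OF assms(3)]] by simp

lemma wnorm_triangle_diff:
  assumes "1 \<le> p" "x \<in> wspace K p" "y \<in> wspace K p"
  shows "wnorm K p (\<lambda>i. x i - y i) \<le> wnorm K p x + wnorm K p y"
  using wnorm_triangle[OF assms(1,2) wspace_uminus[OF assms(3)]] by (simp add: wnorm_uminus)

lemma wspace_restr: "1 \<le> p \<Longrightarrow> x \<in> wspace K p \<Longrightarrow> restr E x \<in> wspace K p"
  by (rule wspace_mono[of x]) (auto simp: restr_def)

lemma wnorm_restr_le: "1 \<le> p \<Longrightarrow> x \<in> wspace K p \<Longrightarrow> wnorm K p (restr E x) \<le> wnorm K p x"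
  by (rule wnorm_mono) (auto simp: restr_def)

lemma wsum_coord:
  assumes "\<phi> \<in> K" "i < M"
  shows "\<phi> i * \<bar>x i\<bar> powr p \<le> wsum \<phi> p M x"
  unfolding wsum_def using assms
  by (intro member_le_sum[where f = "\<lambda>i. \<phi> i * \<bar>x i\<bar> powr p"]) (auto simp: K_nonneg)

lemma abs_coord_le_wnorm:
  assumes "1 \<le> p" "x \<in> wspace K p"
  shows "\<bar>x i\<bar> \<le> wnorm K p x"
proof -
  obtain \<phi> where \<phi>: "\<phi> \<in> K" "\<phi> i = 1" using K_unit by blast
  have "\<bar>x i\<bar> powr p \<le> wnorm K p x powr p"
    using wsum_coord[OF \<phi>(1), of i "Suc i" x p] wsum_le_of_wnorm_le[OF assms order_refl \<phi>(1), of "Suc i"] \<phi>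
    by simp
  then show ?thesis
    using assms by (auto intro: powr_le_powr_imp_le)
qed

section \<open>Finitely supported and disjointly supported vectors\<close>

lemma wsum_finite_support_le:
  assumes "\<phi> \<in> K" "finite A" "\<And>i. i \<notin> A \<Longrightarrow> x i = 0"
  shows "wsum \<phi> p M x \<le> (\<Sum>i\<in>A. \<bar>x i\<bar> powr p)"
proof -
  have "wsum \<phi> p M x \<le> (\<Sum>i<M. \<bar>x i\<bar> powr p)"
    unfolding wsum_def using K_le_one[OF assms(1)] K_nonneg[OF assms(1)]
    by (intro sum_mono) (simp add: mult_left_le_one_le)
  also have "\<dots> = (\<Sum>i\<in>A \<inter> {..<M}. \<bar>x i\<bar> powr p)"
    using assms by (intro sum.mono_neutral_right) auto
  also have "\<dots> \<le> (\<Sum>i\<in>A. \<bar>x i\<bar> powr p)"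
    using assms by (intro sum_mono2) auto
  finally show ?thesis .
qed

lemma wspace_finite_support:
  assumes "finite A" "\<And>i. i \<notin> A \<Longrightarrow> x i = 0"
  shows "x \<in> wspace K p"
  by (rule wspaceI, rule wsum_finite_support_le) (use assms in auto)

lemma wmod_finite_support_le:
  assumes "finite A" "\<And>i. i \<notin> A \<Longrightarrow> x i = 0"
  shows "wmod K p x \<le> (\<Sum>i\<in>A. \<bar>x i\<bar> powr p)"
  by (rule wmod_least, rule wsum_finite_support_le) (use assms in auto)

lemma wspace_indicator [simp]: "finite A \<Longrightarrow> indicator A \<in> wspace K p"
  by (rule wspace_finite_support[of A]) auto

lemma wmod_indicator_le: "finite A \<Longrightarrow> wmod K p (indicator A) \<le> card A"
  using wmod_finite_support_le[of A "indicator A" p] by (simp add: indicator_def)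

lemma wnorm_indicator_le:
  assumes "finite A" "1 \<le> p"
  shows "wnorm K p (indicator A) \<le> real (card A) powr (1 / p)"
  unfolding wnorm_def using assms
  by (intro powr_mono2 wmod_indicator_le wmod_nonneg wspace_indicator) auto

text \<open>The upper \<open>p\<close>-estimate: for disjoint supports each \<open>wsum\<close> is
  additive, and a supremum of sums is at most the sum of the suprema. The supports may
  interlace.\<close>

lemma wmod_add_disjoint:
  assumes "x \<in> wspace K p" "y \<in> wspace K p" "1 \<le> p" "\<And>i. x i = 0 \<or> y i = 0"
  shows "wmod K p (\<lambda>i. x i + y i) \<le> wmod K p x + wmod K p y"
proof (rule wmod_least)
  fix \<phi> M assume \<phi>: "\<phi> \<in> K"
  have "\<bar>x i + y i\<bar> powr p = \<bar>x i\<bar> powr p + \<bar>y i\<bar> powr p" for i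
    using assms(4)[of i] assms(3) by auto
  then have "wsum \<phi> p M (\<lambda>i. x i + y i) = wsum \<phi> p M x + wsum \<phi> p M y"
    by (simp add: wsum_def distrib_left sum.distrib)
  then show "wsum \<phi> p M (\<lambda>i. x i + y i) \<le> wmod K p x + wmod K p y"
    using wsum_le_wmod[OF assms(1) \<phi>, of M] wsum_le_wmod[OF assms(2) \<phi>, of M] by simp
qed

lemma wnorm_add_disjoint:
  assumes "x \<in> wspace K p" "y \<in> wspace K p" "1 \<le> p" "\<And>i. x i = 0 \<or> y i = 0"
    and "wnorm K p x \<le> A" "wnorm K p y \<le> B"
  shows "wnorm K p (\<lambda>i. x i + y i) \<le> (A powr p + B powr p) powr (1 / p)"
proof -
  have "wmod K p (\<lambda>i. x i + y i) \<le> A powr p + B powr p"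
    using wmod_add_disjoint[OF assms(1-4)] wnorm_powr[of x p] wnorm_powr[of y p]
      powr_mono2[OF _ _ assms(5), of p] powr_mono2[OF _ _ assms(6), of p] assms by auto
  then show ?thesis
    unfolding wnorm_def using assms(1-3)
    by (intro powr_mono2 wmod_nonneg wspace_add) auto
qed

end

section \<open>Lower estimates for successive blocks\<close>

text \<open>An empty set stands in this relation to every set, so the relation is not transitive;
  successive families are therefore lists ordered pairwise by \<open>sorted_wrt\<close>. Blocks may
  be empty or infinite.\<close>

definition before :: "nat set \<Rightarrow> nat set \<Rightarrow> bool" where
  "before A B \<longleftrightarrow> (\<forall>a\<in>A. \<forall>b\<in>B. a < b)"

lemma before_subset: "before A B \<Longrightarrow> A' \<subseteq> A \<Longrightarrow> B' \<subseteq> B \<Longrightarrow> before A' B'"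
  by (auto simp: before_def)

lemma sorted_wrt_before_Int: "sorted_wrt before Es \<Longrightarrow> sorted_wrt before (map (\<lambda>E. E \<inter> S) Es)"
  unfolding sorted_wrt_map by (erule sorted_wrt_mono_rel[rotated]) (auto intro: before_subset)

text \<open>Each nonempty block pushes the next one at least one place to the right. Hence late
  blocks in a list start late, which is what admissibility requires.\<close>

lemma sorted_wrt_before_index_le:
  assumes "sorted_wrt before Es" "\<And>E. E \<in> set Es \<Longrightarrow> E \<noteq> {}" "j < length Es" "a \<in> Es ! j"
  shows "j \<le> a"
  using assms(3,4)
proof (induction j arbitrary: a)
  case (Suc j)
  obtain b where b: "b \<in> Es ! j" using assms(2) Suc.prems by fastforce
  have "before (Es ! j) (Es ! Suc j)"
    using sorted_wrt_nth_less[OF assms(1), of j "Suc j"] Suc.prems by simp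
  then have "b < a" using b Suc.prems by (auto simp: before_def)
  then show ?case using Suc.IH[OF _ b] Suc.prems by simp
qed simp

lemma restr_restr: "restr A (restr B x) = restr (A \<inter> B) x"
  by (auto simp: restr_def)

context tsirelson_weights begin

section \<open>Admissible families and the weak-type inequality\<close>

lemma wsum_restr: "0 < p \<Longrightarrow> wsum \<phi> p M (restr E x) = (\<Sum>i<M. (if i \<in> E then \<phi> i else 0) * \<bar>x i\<bar> powr p)"
  unfolding wsum_def restr_def by (intro sum.cong) auto

lemma wsum_mono_length: "\<phi> \<in> K \<Longrightarrow> M \<le> M' \<Longrightarrow> wsum \<phi> p M x \<le> wsum \<phi> p M' x"
  unfolding wsum_def by (intro sum_mono2) (auto simp: K_nonneg)

text \<open>Weights that are nearly optimal on the individual \<open>E j\<close> are glued by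
  \<open>K_admissible\<close> into a single weight that tests \<open>x\<close> on all of
  them.\<close>

lemma wmod_admissible_le:
  assumes "1 \<le> p" "x \<in> wspace K p" "admissible k E"
  shows "(1/2) * (\<Sum>j<k. wmod K p (restr (E j) x)) \<le> wmod K p x"
proof -
  have k: "0 < k" using assms(3) by (simp add: admissible_def)
  have "(1/2) * (\<Sum>j<k. wmod K p (restr (E j) x) - e) \<le> wmod K p x" if e: "0 < e" for e
  proof -
    have "\<exists>\<phi> M. \<phi> \<in> K \<and> wmod K p (restr (E j) x) - e < wsum \<phi> p M (restr (E j) x)" for j
      by (rule wmod_approx[of "wmod K p (restr (E j) x) - e" p "restr (E j) x"]) (use e in auto)
    then obtain \<phi> M where \<phi>M: "\<And>j. \<phi> j \<in> K"
      "\<And>j. wmod K p (restr (E j) x) - e < wsum (\<phi> j) p (M j) (restr (E j) x)"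
      by metis
    obtain \<psi> where \<psi>: "\<psi> \<in> K" "\<forall>i. (1/2) * (\<Sum>j<k. if i \<in> E j then \<phi> j i else 0) \<le> \<psi> i"
      using K_admissible[OF assms(3), of \<phi>] \<phi>M by blast
    \<comment> \<open>A common length for the \<open>k\<close> finite sums, so that they can be
      added coordinate by coordinate.\<close>
    define N where "N = Max (M ` {..<k})"
    have "(1/2) * (\<Sum>j<k. wmod K p (restr (E j) x) - e) \<le> (1/2) * (\<Sum>j<k. wsum (\<phi> j) p N (restr (E j) x))"
    proof (intro mult_left_mono sum_mono)
      fix j assume "j \<in> {..<k}"
      then have "M j \<le> N" by (simp add: N_def)
      then show "wmod K p (restr (E j) x) - e \<le> wsum (\<phi> j) p N (restr (E j) x)"
        using \<phi>M wsum_mono_length by (meson less_imp_le order_trans)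
    qed simp
    also have "\<dots> = (1/2) * (\<Sum>j<k. \<Sum>i<N. (if i \<in> E j then \<phi> j i else 0) * \<bar>x i\<bar> powr p)"
      using assms by (simp add: wsum_restr)
    also have "\<dots> = (\<Sum>i<N. (1/2) * (\<Sum>j<k. if i \<in> E j then \<phi> j i else 0) * \<bar>x i\<bar> powr p)"
      by (subst sum.swap) (simp add: sum_distrib_left sum_distrib_right mult.assoc)
    also have "\<dots> \<le> wsum \<psi> p N x"
      unfolding wsum_def by (intro sum_mono mult_right_mono) (use \<psi> in auto)
    also have "\<dots> \<le> wmod K p x" by (rule wsum_le_wmod[OF assms(2) \<psi>(1)])
    finally show ?thesis .
  qed
  then have *: "(1/2) * (\<Sum>j<k. wmod K p (restr (E j) x)) \<le> wmod K p x + real k * e / 2" if "0 < e" for e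
    using that by (fastforce simp: sum_subtractf algebra_simps)
  show ?thesis
  proof (rule field_le_epsilon)
    fix e :: real assume "0 < e"
    then show "(1/2) * (\<Sum>j<k. wmod K p (restr (E j) x)) \<le> wmod K p x + e"
      using *[of "2 * e / real k"] k by simp
  qed
qed

text \<open>A strict lower bound is witnessed by one finite sum, which sees only finitely many
  coordinates.\<close>

lemma wmod_restr_finite_approx:
  assumes "1 \<le> p" "x \<in> wspace K p" "c < wmod K p (restr E x)"
  shows "\<exists>M. \<forall>N\<ge>M. c < wmod K p (restr (E \<inter> {..<N}) x)"
proof -
  obtain \<phi> M where \<phi>: "\<phi> \<in> K" "c < wsum \<phi> p M (restr E x)"
    using wmod_approx[OF assms(3)] by blast
  have "c < wmod K p (restr (E \<inter> {..<N}) x)" if "M \<le> N" for N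
  proof -
    have "wsum \<phi> p M (restr E x) = wsum \<phi> p M (restr (E \<inter> {..<N}) x)"
      unfolding wsum_def using that by (intro sum.cong) (auto simp: restr_def)
    then show ?thesis
      using \<phi> wsum_le_wmod[OF wspace_restr[OF assms(1,2)] \<phi>(1)] by (metis less_le_trans)
  qed
  then show ?thesis by blast
qed

text \<open>The latter half of any N successive nonempty blocks starts beyond N/2, hence is admissible.\<close>

lemma successive_finite_blocks_le:
  assumes "1 \<le> p" "x \<in> wspace K p" "sorted_wrt before Es"
    and fin: "\<And>E. E \<in> set Es \<Longrightarrow> finite E \<and> E \<noteq> {}"
    and ge: "\<And>E. E \<in> set Es \<Longrightarrow> c \<le> wmod K p (restr E x)" and "0 \<le> c"
  shows "real (length Es) * c \<le> 4 * wmod K p x"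
proof (cases "Es = []")
  case True
  then show ?thesis using wmod_nonneg[OF assms(2)] by simp
next
  case False
  define n where "n = length Es"
  \<comment> \<open>Rounding up gives \<open>n \<le> 2 * k\<close>, and still
    \<open>k \<le> Suc (n - k)\<close>: after \<open>n - k\<close> skipped blocks the next one has
    1-based minimum at least \<open>Suc (n - k)\<close>. The constant 4 is 2 for the discarded half
    times 2 for the factor 1/2 in admissible sums.\<close>
  define k where "k = (n + 1) div 2"
  define E where "E = (\<lambda>j. Es ! (n - k + j))"
  have n: "0 < n" using False by (simp add: n_def)
  have k: "0 < k" "k \<le> n" "n \<le> 2 * k" "k \<le> Suc (n - k)" using n unfolding k_def by linarith+
  have E: "E j \<in> set Es" if "j < k" for j
    using that k by (simp add: E_def n_def)
  have "admissible k E"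
    unfolding admissible_def
  proof (intro conjI allI impI)
    show "1 \<le> k" using k by simp
    show "finite (E j)" "E j \<noteq> {}" if "j < k" for j using fin[OF E[OF that]] by auto
    show "Max (E j) < Min (E (Suc j))" if "Suc j < k" for j
    proof -
      have "before (E j) (E (Suc j))"
        unfolding E_def using that k by (intro sorted_wrt_nth_less[OF assms(3)]) (auto simp: n_def)
      then show ?thesis
        using fin[OF E[OF that]] fin[OF E[of j]] that by (auto simp: before_def)
    qed
    have "n - k \<le> Min (E 0)"
      using fin[OF E[of 0]] k n sorted_wrt_before_index_le[OF assms(3), of "n - k"] fin
      by (auto simp: E_def n_def)
    then show "k \<le> Suc (Min (E 0))" using k by simp
  qed
  from wmod_admissible_le[OF assms(1,2) this]
  have "(\<Sum>j<k. wmod K p (restr (E j) x)) \<le> 2 * wmod K p x" by simp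
  moreover have "real k * c \<le> (\<Sum>j<k. wmod K p (restr (E j) x))"
    using sum_mono[of "{..<k}" "\<lambda>_. c" "\<lambda>j. wmod K p (restr (E j) x)"] ge E by simp
  moreover have "real n * c \<le> 2 * (real k * c)"
    using k \<open>0 \<le> c\<close> by (simp add: mult_right_mono flip: mult.assoc)
  ultimately show ?thesis by (simp add: n_def)
qed

text \<open>Reduction to finite blocks: for \<open>d < c\<close> all blocks can be cut at one common
  \<open>N\<close> while keeping modulus above \<open>d\<close>. As \<open>d > 0\<close>, the cut
  blocks are nonempty.\<close>

lemma successive_blocks_le:
  assumes "1 \<le> p" "x \<in> wspace K p" "sorted_wrt before Es"
    and ge: "\<And>E. E \<in> set Es \<Longrightarrow> c \<le> wmod K p (restr E x)"
  shows "real (length Es) * c \<le> 4 * wmod K p x"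
proof (rule dense_le)
  fix y assume y: "y < real (length Es) * c"
  show "y \<le> 4 * wmod K p x"
  proof (cases "y \<le> 0")
    case True
    then show ?thesis using wmod_nonneg[OF assms(2)] by simp
  next
    case False
    then have pos: "0 < real (length Es)" "0 < c"
      using y zero_less_mult_iff[of "real (length Es)" c] by auto
    define d where "d = y / real (length Es)"
    have d: "0 < d" "d < c" using y pos False by (auto simp: d_def field_simps)
    have "\<forall>E\<in>set Es. \<exists>M. \<forall>N\<ge>M. d < wmod K p (restr (E \<inter> {..<N}) x)"
      using d ge by (auto intro!: wmod_restr_finite_approx[OF assms(1,2)] intro: less_le_trans)
    then obtain M where M: "\<And>E N. E \<in> set Es \<Longrightarrow> M E \<le> N \<Longrightarrow> d < wmod K p (restr (E \<inter> {..<N}) x)"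
      by metis
    define N where "N = Max (M ` set Es)"
    have N: "d < wmod K p (restr (E \<inter> {..<N}) x)" if "E \<in> set Es" for E
      using that by (intro M) (auto simp: N_def)
    have ne: "E \<inter> {..<N} \<noteq> {}" if "E \<in> set Es" for E
    proof
      assume "E \<inter> {..<N} = {}"
      then have "restr (E \<inter> {..<N}) x = (\<lambda>i. 0)" by (simp add: restr_def)
      then show False using N[OF that] d by simp
    qed
    have "real (length (map (\<lambda>E. E \<inter> {..<N}) Es)) * d \<le> 4 * wmod K p x"
      by (rule successive_finite_blocks_le[OF assms(1,2) sorted_wrt_before_Int[OF assms(3)]])
        (use ne N d in \<open>auto intro: less_imp_le\<close>)
    then show ?thesis using pos by (simp add: d_def)
  qed
qed

text \<open>Otherwise one could find arbitrarily many successive finite blocks of modulus above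
  \<open>e\<close>, against \<open>successive_blocks_le\<close>.\<close>

lemma wmod_tail_small:
  assumes "1 \<le> p" "x \<in> wspace K p" "0 < e"
  shows "\<exists>N. \<forall>n\<ge>N. wmod K p (restr {n..} x) \<le> e"
proof (rule ccontr)
  assume "\<not> ?thesis"
  then have *: "\<exists>n\<ge>N. e < wmod K p (restr {n..} x)" for N by (auto simp: not_le)
  have "\<exists>M>N. e < wmod K p (restr {N..<M} x)" for N
  proof -
    obtain n where n: "N \<le> n" "e < wmod K p (restr {n..} x)" using * by blast
    then have "e < wmod K p (restr {N..} x)"
      using wmod_mono[OF wspace_restr[OF assms(1,2), of "{N..}"] assms(1), of "restr {n..} x"]
      by (force simp: restr_def)
    from wmod_restr_finite_approx[OF assms(1,2) this]
    obtain M where M: "\<forall>M'\<ge>M. e < wmod K p (restr ({N..} \<inter> {..<M'}) x)" by blast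
    have "{N..} \<inter> {..<max M (Suc N)} = {N..<max M (Suc N)}" by auto
    then have "e < wmod K p (restr {N..<max M (Suc N)} x)" using M by (metis max.cobounded1)
    then show ?thesis by (intro exI[of _ "max M (Suc N)"]) auto
  qed
  then obtain h where h: "\<And>N. N < h N" "\<And>N. e < wmod K p (restr {N..<h N} x)" by metis
  \<comment> \<open>The iterates of \<open>h\<close> are the endpoints of the successive bad
    blocks.\<close>
  define a where "a = (\<lambda>j. (h ^^ j) 0)"
  have a: "a (Suc j) = h (a j)" for j by (simp add: a_def)
  then have "strict_mono a" using h(1) by (simp add: strict_mono_Suc_iff)
  then have mono: "i \<le> j \<Longrightarrow> a i \<le> a j" for i j by (simp add: strict_mono_less_eq)
  have "real n * e \<le> 4 * wmod K p x" for n
  proof -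
    have "before {a i..<a (Suc i)} {a j..<a (Suc j)}" if "i < j" for i j
      using mono[of "Suc i" j] that by (auto simp: before_def)
    then have "sorted_wrt before (map (\<lambda>j. {a j..<a (Suc j)}) [0..<n])"
      by (simp add: sorted_wrt_iff_nth_less)
    from successive_blocks_le[OF assms(1,2) this, of e]
    show ?thesis using h(2) by (auto simp: a intro: less_imp_le)
  qed
  moreover obtain n where "4 * wmod K p x < real n * e" using assms(3) reals_Archimedean3 by blast
  ultimately show False by (meson not_le)
qed

lemma wnorm_tail_small:
  assumes "1 \<le> p" "x \<in> wspace K p" "0 < e"
  shows "\<exists>N. \<forall>n\<ge>N. wnorm K p (restr {n..} x) \<le> e"
proof -
  obtain N where N: "\<forall>n\<ge>N. wmod K p (restr {n..} x) \<le> e powr p"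
    using wmod_tail_small[OF assms(1,2), of "e powr p"] assms(3) by auto
  have "wnorm K p (restr {n..} x) \<le> e" if "N \<le> n" for n
    using N that assms by (intro wnorm_leI order_trans[OF wsum_le_wmod[OF wspace_restr]]) auto
  then show ?thesis by blast
qed

text \<open>Of \<open>n + 1\<close> successive blocks the smallest has modulus at most
  \<open>4 * wmod K p x / (n + 1)\<close> by the weak-type inequality. Removing it leaves a
  successive family, and induction sums these bounds.\<close>

lemma sum_successive_blocks_powr_le:
  assumes "1 \<le> p" "x \<in> wspace K p" "1 < s" "sorted_wrt before Es"
  shows "(\<Sum>E\<leftarrow>Es. wmod K p (restr E x) powr s) \<le> (4 * wmod K p x) powr s * (\<Sum>i<length Es. real (Suc i) powr (- s))"
  using assms(4)
proof (induction "length Es" arbitrary: Es)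
  case (Suc n Es)
  have "\<exists>E\<in>set Es. \<forall>F\<in>set Es. wmod K p (restr E x) \<le> wmod K p (restr F x)"
    using ex_min_if_finite[of "(\<lambda>E. wmod K p (restr E x)) ` set Es"] Suc.hyps(2)
    by (fastforce simp: not_less)
  then obtain E where E: "E \<in> set Es" "\<And>F. F \<in> set Es \<Longrightarrow> wmod K p (restr E x) \<le> wmod K p (restr F x)"
    by blast
  obtain us vs where Es: "Es = us @ E # vs" using split_list[OF E(1)] by blast
  have nn: "0 \<le> wmod K p (restr E x)" by (rule wmod_nonneg[OF wspace_restr[OF assms(1,2)]])
  have "real (Suc n) * wmod K p (restr E x) \<le> 4 * wmod K p x"
    using successive_blocks_le[OF assms(1,2) Suc.prems E(2)] Suc.hyps(2) by simp
  then have "wmod K p (restr E x) \<le> (4 * wmod K p x) * inverse (real (Suc n))"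
    by (simp add: field_simps)
  then have "wmod K p (restr E x) powr s \<le> ((4 * wmod K p x) * inverse (real (Suc n))) powr s"
    using assms nn by (intro powr_mono2) auto
  also have "\<dots> = (4 * wmod K p x) powr s * real (Suc n) powr (- s)"
    by (simp add: powr_mult inverse_powr powr_minus)
  finally have 1: "wmod K p (restr E x) powr s \<le> (4 * wmod K p x) powr s * real (Suc n) powr (- s)" .
  have n: "n = length (us @ vs)" using Suc.hyps(2) by (simp add: Es)
  have "sorted_wrt before (us @ vs)" using Suc.prems by (auto simp: Es sorted_wrt_append)
  from Suc.hyps(1)[OF n this]
  have "(\<Sum>E\<leftarrow>us @ vs. wmod K p (restr E x) powr s) \<le> (4 * wmod K p x) powr s * (\<Sum>i<n. real (Suc i) powr (- s))"
    by (simp flip: n add: n)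
  with 1 show ?case
    unfolding Suc.hyps(2)[symmetric] by (simp add: Es distrib_left)
qed simp

text \<open>The \<open>q\<close>-th power of the norm is the power \<open>s = q / p\<close> of the
  modulus. Since \<open>s > 1\<close>, the series from the previous lemma converges and bounds the
  sum independently of the number of blocks.\<close>

lemma wnorm_lower_estimate:
  assumes "1 \<le> p" "p < q"
  obtains C where "0 \<le> C" "\<And>x Es. x \<in> wspace K p \<Longrightarrow> sorted_wrt before Es \<Longrightarrow>
    (\<Sum>E\<leftarrow>Es. wnorm K p (restr E x) powr q) \<le> C * wnorm K p x powr q"
proof
  define s where "s = q / p"
  have s: "1 < s" using assms by (simp add: s_def)
  have "summable (\<lambda>i. real i powr (- s))" using s by (simp add: summable_real_powr_iff)
  then have sm: "summable (\<lambda>i. real (Suc i) powr (- s))" by (subst summable_Suc_iff)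
  define Z where "Z = (\<Sum>i. real (Suc i) powr (- s))"
  show "0 \<le> 4 powr s * Z" unfolding Z_def by (intro mult_nonneg_nonneg suminf_nonneg[OF sm]) auto
  fix x Es assume x: "x \<in> wspace K p" and Es: "sorted_wrt before Es"
  have eq: "wnorm K p y powr q = wmod K p y powr s" if "y \<in> wspace K p" for y
    by (simp add: wnorm_def powr_powr s_def)
  have "(\<Sum>E\<leftarrow>Es. wnorm K p (restr E x) powr q) = (\<Sum>E\<leftarrow>Es. wmod K p (restr E x) powr s)"
    by (simp add: eq wspace_restr[OF assms(1) x])
  also have "\<dots> \<le> (4 * wmod K p x) powr s * (\<Sum>i<length Es. real (Suc i) powr (- s))"
    by (rule sum_successive_blocks_powr_le[OF assms(1) x s Es])
  also have "\<dots> \<le> (4 * wmod K p x) powr s * Z"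
    unfolding Z_def by (intro mult_left_mono sum_le_suminf sm) auto
  finally show "(\<Sum>E\<leftarrow>Es. wnorm K p (restr E x) powr q) \<le> 4 powr s * Z * wnorm K p x powr q"
    using wmod_nonneg[OF x] by (simp add: eq[OF x] powr_mult mult_ac)
qed

text \<open>The singletons of \<open>A\<close> are successive blocks of modulus at least 1. This
  keeps spread-out indicator vectors far apart.\<close>

lemma card_le_wmod_indicator:
  assumes "1 \<le> p" "finite A"
  shows "real (card A) \<le> 4 * wmod K p (indicator A)"
proof -
  have "sorted_wrt before (map (\<lambda>a. {a}) (sorted_list_of_set A))"
    using sorted_list_of_set.strict_sorted_key_list_of_set[of A] by (simp add: sorted_wrt_map before_def)
  from successive_blocks_le[OF assms(1) wspace_indicator[OF assms(2)] this, of 1]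
  have "(\<And>a. a \<in> A \<Longrightarrow> 1 \<le> wmod K p (restr {a} (indicator A))) \<Longrightarrow> ?thesis"
    using assms(2) by auto
  moreover have "1 \<le> wmod K p (restr {a} (indicator A))" if "a \<in> A" for a
  proof -
    obtain \<phi> where \<phi>: "\<phi> \<in> K" "\<phi> a = 1" using K_unit by blast
    show ?thesis
      using wsum_coord[OF \<phi>(1), of a "Suc a" "restr {a} (indicator A)" p] \<phi> that
        wsum_le_wmod[OF wspace_restr[OF assms(1) wspace_indicator[OF assms(2)]] \<phi>(1), of "Suc a" "{a}"]
      by (simp add: restr_def)
  qed
  ultimately show ?thesis by blast
qed

end

section \<open>Iterated limits along an ultrafilter\<close>

definition is_ultra :: "'a filter \<Rightarrow> bool" where
  "is_ultra F \<longleftrightarrow> F \<noteq> bot \<and> (\<forall>P. eventually P F \<or> eventually (\<lambda>x. \<not> P x) F)"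

text \<open>Zorn's lemma for proper filters below \<open>sequentially\<close>; an element maximal
  for \<open>R\<close> is a minimal filter, that is, an ultrafilter.\<close>

lemma ex_free_ultrafilter: "\<exists>U :: nat filter. U \<le> sequentially \<and> is_ultra U"
proof -
  define A where "A = {F :: nat filter. F \<noteq> bot \<and> F \<le> sequentially}"
  define R where "R = (\<lambda>F G :: nat filter. G \<le> F)"
  have "partial_order_on A (relation_of R A)"
    by (rule partial_order_on_relation_ofI) (auto simp: R_def)
  then have "\<exists>U\<in>A. \<forall>F\<in>A. R U F \<longrightarrow> F = U"
  proof (rule predicate_Zorn)
    fix C assume C: "C \<in> Chains (relation_of R A)"
    then have CA: "C \<subseteq> A" by (auto simp: Chains_def relation_of_def)
    show "\<exists>u\<in>A. \<forall>a\<in>C. R a u"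
    proof (cases "C = {}")
      case True
      then show ?thesis by (auto simp: A_def intro!: exI[of _ sequentially])
    next
      case False
      \<comment> \<open>A chain is directed downwards, so a property holds eventually for its
        infimum only if it does so for a member. In particular the infimum stays proper.\<close>
      have "eventually P (Inf C) \<longleftrightarrow> (\<exists>b\<in>C. eventually P b)" for P
      proof (rule eventually_Inf_base[OF False])
        fix F G assume "F \<in> C" "G \<in> C"
        then have "F \<le> G \<or> G \<le> F"
          using C by (auto simp: Chains_def relation_of_def R_def)
        then show "\<exists>x\<in>C. x \<le> inf F G"
          using \<open>F \<in> C\<close> \<open>G \<in> C\<close> by (metis inf.absorb1 inf.absorb2 order_refl)
      qed
      then have "Inf C \<noteq> bot"
        using CA by (auto simp: trivial_limit_def A_def)
      moreover have "Inf C \<le> sequentially"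
        using False CA by (auto simp: A_def intro: Inf_lower2)
      ultimately show ?thesis
        by (intro bexI[of _ "Inf C"]) (auto simp: A_def R_def Inf_lower)
    qed
  qed
  then obtain U where U: "U \<noteq> bot" "U \<le> sequentially"
    and min: "\<And>F. F \<noteq> bot \<Longrightarrow> F \<le> U \<Longrightarrow> F = U"
    unfolding A_def R_def by (auto intro: order_trans)
  have "eventually P U" if "\<not> eventually (\<lambda>x. \<not> P x) U" for P
  proof -
    \<comment> \<open>Refining \<open>U\<close> by \<open>P\<close> stays proper because the
      complement is not eventual; minimality then forces \<open>P\<close> into
      \<open>U\<close>.\<close>
    have "inf U (principal {x. P x}) \<noteq> bot"
      using that by (simp add: trivial_limit_def eventually_inf_principal)
    then have "inf U (principal {x. P x}) = U" by (intro min) auto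
    then have "U \<le> principal {x. P x}" by (metis inf.cobounded2)
    then show ?thesis by (simp add: le_principal)
  qed
  then show ?thesis using U by (auto simp: is_ultra_def)
qed

definition free_ultra :: "nat filter" where
  "free_ultra = (SOME U. U \<le> sequentially \<and> is_ultra U)"

lemma free_ultra_le: "free_ultra \<le> sequentially" and is_ultra_free_ultra: "is_ultra free_ultra"
  using someI_ex[OF ex_free_ultrafilter] by (simp_all add: free_ultra_def)

lemma free_ultra_neq_bot [simp]: "free_ultra \<noteq> bot"
  using is_ultra_free_ultra by (simp add: is_ultra_def)

text \<open>The \<open>k\<close>-fold product of the free ultrafilter, so that a limit along it is
  an iterated limit with the last entry innermost. The tail is quantified after the head, hence
  eventually lies beyond it. Having a single filter allows eventual properties to be
  intersected.\<close>

primrec tuples :: "nat \<Rightarrow> nat list filter" where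
  "tuples 0 = principal {[]}"
| "tuples (Suc k) = Abs_filter (\<lambda>P. \<forall>\<^sub>F n in free_ultra. \<forall>\<^sub>F ns in tuples k. P (n # ns))"

lemma eventually_tuples_0 [simp]: "eventually P (tuples 0) \<longleftrightarrow> P []"
  by (simp add: eventually_principal)

lemma eventually_tuples_Suc:
  "eventually P (tuples (Suc k)) \<longleftrightarrow> (\<forall>\<^sub>F n in free_ultra. \<forall>\<^sub>F ns in tuples k. P (n # ns))"
proof -
  have "is_filter (\<lambda>P. \<forall>\<^sub>F n in free_ultra. \<forall>\<^sub>F ns in tuples k. P (n # ns))"
  proof
    fix P Q
    assume "\<forall>\<^sub>F n in free_ultra. \<forall>\<^sub>F ns in tuples k. P (n # ns)"
      and "\<forall>\<^sub>F n in free_ultra. \<forall>\<^sub>F ns in tuples k. Q (n # ns)"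
    then show "\<forall>\<^sub>F n in free_ultra. \<forall>\<^sub>F ns in tuples k. P (n # ns) \<and> Q (n # ns)"
      by eventually_elim (rule eventually_conj)
  next
    fix P Q :: "nat list \<Rightarrow> bool"
    assume "\<forall>ns. P ns \<longrightarrow> Q ns" "\<forall>\<^sub>F n in free_ultra. \<forall>\<^sub>F ns in tuples k. P (n # ns)"
    then show "\<forall>\<^sub>F n in free_ultra. \<forall>\<^sub>F ns in tuples k. Q (n # ns)"
      by (auto elim!: eventually_mono)
  qed simp
  then show ?thesis by (simp add: eventually_Abs_filter)
qed

declare tuples.simps [simp del]

lemma is_ultra_tuples: "is_ultra (tuples k)"
proof (induction k)
  case 0
  then show ?case by (simp add: is_ultra_def trivial_limit_def)
next
  case (Suc k)
  have U: "eventually P free_ultra \<or> eventually (\<lambda>x. \<not> P x) free_ultra" for P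
    using is_ultra_free_ultra by (simp add: is_ultra_def)
  have "eventually P (tuples (Suc k)) \<or> eventually (\<lambda>x. \<not> P x) (tuples (Suc k))" for P
    using U[of "\<lambda>n. \<forall>\<^sub>F ns in tuples k. P (n # ns)"]
  proof
    assume *: "\<forall>\<^sub>F n in free_ultra. \<not> (\<forall>\<^sub>F ns in tuples k. P (n # ns))"
    have "\<forall>\<^sub>F n in free_ultra. \<forall>\<^sub>F ns in tuples k. \<not> P (n # ns)"
      using * by eventually_elim (use Suc in \<open>auto simp: is_ultra_def\<close>)
    then show ?thesis by (simp add: eventually_tuples_Suc)
  qed (simp add: eventually_tuples_Suc)
  moreover have "tuples (Suc k) \<noteq> bot"
    using Suc free_ultra_neq_bot
    unfolding trivial_limit_def eventually_tuples_Suc is_ultra_def by simp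
  ultimately show ?case by (simp add: is_ultra_def)
qed

lemma tuples_neq_bot [simp]: "tuples k \<noteq> bot"
  using is_ultra_tuples by (simp add: is_ultra_def)

lemma eventually_tuples_tl: "eventually P (tuples k) \<Longrightarrow> eventually (\<lambda>ns. P (tl ns)) (tuples (Suc k))"
  by (simp add: eventually_tuples_Suc)

lemma eventually_tuples_length: "\<forall>\<^sub>F ns in tuples k. length ns = k"
  by (induction k) (simp_all add: eventually_tuples_Suc)

lemma eventually_tuples_gt: "\<forall>\<^sub>F ns in tuples k. \<forall>n\<in>set ns. N < n"
proof (induction k)
  case (Suc k)
  have "\<forall>\<^sub>F n in free_ultra. N < n"
    using free_ultra_le eventually_gt_at_top by (rule filter_leD)
  then have "\<forall>\<^sub>F n in free_ultra. \<forall>\<^sub>F ns in tuples k. \<forall>m\<in>set (n # ns). N < m"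
    by eventually_elim (use Suc in simp)
  then show ?case by (simp only: eventually_tuples_Suc)
qed simp

lemma eventually_tuples_distinct: "\<forall>\<^sub>F ns in tuples k. distinct ns"
proof (induction k)
  case (Suc k)
  have "\<forall>\<^sub>F ns in tuples k. distinct (n # ns)" for n
    using eventually_tuples_gt[of n k] Suc by eventually_elim auto
  then show ?case by (simp add: eventually_tuples_Suc)
qed simp

text \<open>Compactness of an interval provides a cluster point, and an ultrafilter converges to
  each of its cluster points.\<close>

lemma is_ultra_bounded_convergent:
  fixes f :: "'a \<Rightarrow> real"
  assumes "is_ultra F" "\<forall>\<^sub>F x in F. \<bar>f x\<bar> \<le> B"
  shows "\<exists>l. (f \<longlongrightarrow> l) F"
proof -
  have "filtermap f F \<noteq> bot" using assms(1) by (simp add: is_ultra_def filtermap_bot_iff)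
  moreover have "eventually (\<lambda>y. y \<in> {-B..B}) (filtermap f F)"
    using assms(2) by (simp add: eventually_filtermap abs_le_iff minus_le_iff conj_commute)
  ultimately obtain l where l: "inf (nhds l) (filtermap f F) \<noteq> bot"
    using compact_Icc[of "-B" B] unfolding compact_filter by blast
  have "(f \<longlongrightarrow> l) F"
  proof (rule topological_tendstoI)
    fix S assume S: "open S" "l \<in> S"
    show "\<forall>\<^sub>F x in F. f x \<in> S"
    proof (rule ccontr)
      assume "\<not> ?thesis"
      then have "\<forall>\<^sub>F x in F. f x \<notin> S" using assms(1) by (auto simp: is_ultra_def)
      then have "\<forall>\<^sub>F y in inf (nhds l) (filtermap f F). y \<notin> S"
        by (intro filter_leD[OF inf_le2]) (simp add: eventually_filtermap)
      moreover have "\<forall>\<^sub>F y in inf (nhds l) (filtermap f F). y \<in> S"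
        using S by (intro filter_leD[OF inf_le1]) (auto simp: eventually_nhds)
      ultimately have "\<forall>\<^sub>F y in inf (nhds l) (filtermap f F). False"
        by eventually_elim simp
      then show False using l by (simp add: trivial_limit_def)
    qed
  qed
  then show ?thesis by blast
qed

section \<open>Concentration under upper estimates\<close>

lemma tendsto_powr_nonneg:
  fixes f :: "'a \<Rightarrow> real"
  assumes "(f \<longlongrightarrow> a) F" "0 < p" "\<And>x. 0 \<le> f x"
  shows "((\<lambda>x. f x powr p) \<longlongrightarrow> a powr p) F"
  by (rule tendsto_powr'[OF assms(1) tendsto_const]) (use assms in auto)

context tsirelson_weights begin

lemma tendsto_wsum:
  assumes "\<And>i. ((\<lambda>z. G z i) \<longlongrightarrow> u i) F" "1 \<le> r"
  shows "((\<lambda>z. wsum \<phi> r M (G z)) \<longlongrightarrow> wsum \<phi> r M u) F"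
  unfolding wsum_def
  by (intro tendsto_sum tendsto_mult tendsto_const tendsto_powr_nonneg tendsto_rabs assms)
    (use assms in auto)

text \<open>Every \<open>wsum\<close> involves finitely many coordinates, so it is continuous under
  coordinatewise convergence; a supremum of such functions is lower semicontinuous.\<close>

lemma wnorm_fatou:
  assumes "1 \<le> r" "F \<noteq> bot" "\<And>i. ((\<lambda>z. G z i) \<longlongrightarrow> u i) F" "0 \<le> A"
    and "\<forall>\<^sub>F z in F. G z \<in> wspace K r \<and> wnorm K r (G z) \<le> A"
  shows "u \<in> wspace K r" "wnorm K r u \<le> A"
proof -
  have *: "wsum \<phi> r M u \<le> A powr r" if "\<phi> \<in> K" for \<phi> M
  proof (rule tendsto_upperbound[OF tendsto_wsum[OF assms(3,1)] _ assms(2)])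
    show "\<forall>\<^sub>F z in F. wsum \<phi> r M (G z) \<le> A powr r"
      using assms(5) by eventually_elim (use wsum_le_of_wnorm_le[OF assms(1)] that in auto)
  qed
  show "u \<in> wspace K r" using * by (rule wspaceI)
  show "wnorm K r u \<le> A" using * by (rule wnorm_leI[OF assms(1,4)])
qed

lemma eventually_wnorm_head_le:
  assumes "1 \<le> r" "\<And>i. ((\<lambda>z. G z i) \<longlongrightarrow> 0) F" "0 < \<eta>"
  shows "\<forall>\<^sub>F z in F. wnorm K r (restr {..<N} (G z)) \<le> \<eta>"
proof -
  have "((\<lambda>z. \<Sum>i<N. \<bar>G z i\<bar> powr r) \<longlongrightarrow> (\<Sum>i<N. \<bar>0\<bar> powr r)) F"
    by (intro tendsto_sum tendsto_powr_nonneg tendsto_rabs assms) (use assms in auto)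
  then have "\<forall>\<^sub>F z in F. (\<Sum>i<N. \<bar>G z i\<bar> powr r) < \<eta> powr r"
    using assms by (intro order_tendstoD) auto
  then show ?thesis
  proof eventually_elim
    case (elim z)
    have "wsum \<phi> r M (restr {..<N} (G z)) \<le> \<eta> powr r" if "\<phi> \<in> K" for \<phi> M
      using wsum_finite_support_le[OF that, of "{..<N}" "restr {..<N} (G z)" r M] elim
      by (simp add: restr_def)
    then show ?case using assms by (intro wnorm_leI) auto
  qed
qed

text \<open>Cutting at \<open>N\<close> leaves the head of \<open>a\<close> and the tail of
  \<open>h\<close>, which are disjoint and obey the upper estimate. The other two pieces cost
  \<open>e\<close> each.\<close>

lemma wnorm_add_almost_disjoint:
  assumes "1 \<le> r" "a \<in> wspace K r" "h \<in> wspace K r" "wnorm K r a \<le> A" "wnorm K r h \<le> B"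
    and "wnorm K r (restr {N..} a) \<le> e" "wnorm K r (restr {..<N} h) \<le> e"
  shows "wnorm K r (\<lambda>i. a i + h i) \<le> (A powr r + B powr r) powr (1 / r) + 2 * e"
proof -
  note [simp] = wspace_restr[OF assms(1)] wspace_add[OF assms(1)] assms(1-3)
  have "(\<lambda>i. a i + h i) = (\<lambda>i. (restr {..<N} a i + restr {N..} h i) + (restr {N..} a i + restr {..<N} h i))"
    by (auto simp: restr_def)
  then have "wnorm K r (\<lambda>i. a i + h i) \<le> wnorm K r (\<lambda>i. restr {..<N} a i + restr {N..} h i)
      + wnorm K r (\<lambda>i. restr {N..} a i + restr {..<N} h i)"
    using wnorm_triangle[of r "\<lambda>i. restr {..<N} a i + restr {N..} h i"] by simp
  moreover have "wnorm K r (\<lambda>i. restr {..<N} a i + restr {N..} h i) \<le> (A powr r + B powr r) powr (1 / r)"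
    by (rule wnorm_add_disjoint)
      (auto intro: order_trans[OF wnorm_restr_le assms(4)] order_trans[OF wnorm_restr_le assms(5)],
        auto simp: restr_def)
  moreover have "wnorm K r (\<lambda>i. restr {N..} a i + restr {..<N} h i) \<le> e + e"
    using wnorm_triangle[of r "restr {N..} a" "restr {..<N} h"] assms(6,7) by simp
  ultimately show ?thesis by simp
qed

text \<open>With the first entry \<open>n\<close> fixed, \<open>F\<close> concentrates by induction
  near a limit \<open>v n\<close>. The vector \<open>v n - u\<close> has norm at most
  \<open>\<Lambda>\<close>, and \<open>F (n # ns) - v n\<close> tends to zero coordinatewise, so the
  two are almost disjoint and their \<open>r\<close>-th powers add: each entry contributes
  \<open>\<Lambda> powr r\<close>.\<close>

lemma tuples_concentration:
  assumes r: "1 \<le> r" and \<Lambda>: "0 \<le> \<Lambda>"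
    and "\<And>ns. length ns = k \<Longrightarrow> F ns \<in> wspace K r \<and> wnorm K r (F ns) \<le> B"
    and "\<And>as bs n m. length as + Suc (length bs) = k \<Longrightarrow>
      wnorm K r (\<lambda>i. F (as @ n # bs) i - F (as @ m # bs) i) \<le> \<Lambda>"
  shows "\<exists>u\<in>wspace K r. (\<forall>i. ((\<lambda>ns. F ns i) \<longlongrightarrow> u i) (tuples k)) \<and>
    (\<forall>\<eta>>0. \<forall>\<^sub>F ns in tuples k. wnorm K r (\<lambda>i. F ns i - u i) \<le> real k powr (1 / r) * \<Lambda> + \<eta>)"
  using assms(3,4)
proof (induction k arbitrary: F)
  case 0
  then show ?case
    by (intro bexI[of _ "F []"])
      (auto intro!: tendsto_eventually simp: less_imp_le)
next
  case (Suc k F)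
  have "\<exists>u\<in>wspace K r. (\<forall>i. ((\<lambda>ns. F (n # ns) i) \<longlongrightarrow> u i) (tuples k)) \<and>
    (\<forall>\<eta>>0. \<forall>\<^sub>F ns in tuples k. wnorm K r (\<lambda>i. F (n # ns) i - u i) \<le> real k powr (1 / r) * \<Lambda> + \<eta>)" for n
  proof (rule Suc.IH)
    show "F (n # ns) \<in> wspace K r \<and> wnorm K r (F (n # ns)) \<le> B" if "length ns = k" for ns
      using Suc.prems(1) that by simp
    show "wnorm K r (\<lambda>i. F (n # as @ n' # bs) i - F (n # as @ m # bs) i) \<le> \<Lambda>"
      if "length as + Suc (length bs) = k" for as bs n' m
      using Suc.prems(2)[of "n # as" bs n' m] that by simp
  qed
  then have "\<exists>v. \<forall>n. v n \<in> wspace K r \<and> (\<forall>i. ((\<lambda>ns. F (n # ns) i) \<longlongrightarrow> v n i) (tuples k)) \<and>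
    (\<forall>\<eta>>0. \<forall>\<^sub>F ns in tuples k. wnorm K r (\<lambda>i. F (n # ns) i - v n i) \<le> real k powr (1 / r) * \<Lambda> + \<eta>)"
    unfolding Bex_def by (intro choice allI)
  then obtain v where v: "\<And>n. v n \<in> wspace K r" "\<And>n i. ((\<lambda>ns. F (n # ns) i) \<longlongrightarrow> v n i) (tuples k)"
    "\<And>n \<eta>. 0 < \<eta> \<Longrightarrow> \<forall>\<^sub>F ns in tuples k. wnorm K r (\<lambda>i. F (n # ns) i - v n i) \<le> real k powr (1 / r) * \<Lambda> + \<eta>"
    by blast
  have len: "\<forall>\<^sub>F ns in tuples (Suc k). length ns = Suc k" by (rule eventually_tuples_length)
  have "\<exists>l. ((\<lambda>ns. F ns i) \<longlongrightarrow> l) (tuples (Suc k))" for i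
    by (rule is_ultra_bounded_convergent[OF is_ultra_tuples, where B = B])
      (use len in eventually_elim, use Suc.prems(1) abs_coord_le_wnorm[OF r] in \<open>blast intro: order_trans\<close>)
  then obtain u where u: "\<And>i. ((\<lambda>ns. F ns i) \<longlongrightarrow> u i) (tuples (Suc k))" by metis
  have B: "0 \<le> B" 
    using order_trans[OF wnorm_nonneg conjunct2[OF Suc.prems(1)[of "replicate (Suc k) 0"]]] by simp
  have uw: "u \<in> wspace K r"
    by (rule wnorm_fatou(1)[OF r tuples_neq_bot u B])
      (use len in eventually_elim, use Suc.prems(1) in blast)
  \<comment> \<open>\<open>F (n # tl ns)\<close> and \<open>F ns\<close> differ in the first entry
    only. Their coordinates converge to those of \<open>v n\<close> and \<open>u\<close>, so the
    exchange bound \<open>\<Lambda>\<close> survives by \<open>wnorm_fatou\<close>.\<close>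
  have vu: "wnorm K r (\<lambda>i. v n i - u i) \<le> \<Lambda>" for n
  proof (rule wnorm_fatou(2)[OF r tuples_neq_bot _ \<Lambda>])
    have "((\<lambda>ns. F (n # tl ns) i) \<longlongrightarrow> v n i) (tuples (Suc k))" for i
      using v(2)[of n i] unfolding tendsto_def by (auto dest: eventually_tuples_tl)
    then show "((\<lambda>ns. F (n # tl ns) i - F ns i) \<longlongrightarrow> v n i - u i) (tuples (Suc k))" for i
      by (intro tendsto_diff u)
    show "\<forall>\<^sub>F ns in tuples (Suc k). (\<lambda>i. F (n # tl ns) i - F ns i) \<in> wspace K r \<and>
        wnorm K r (\<lambda>i. F (n # tl ns) i - F ns i) \<le> \<Lambda>"
      using len
    proof eventually_elim
      case (elim ns)
      then obtain m ms where ns: "ns = m # ms" "length ms = k" by (cases ns) auto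
      then show ?case
        using Suc.prems(2)[of "[]" ms n m] Suc.prems(1)[of ns] Suc.prems(1)[of "n # ms"]
        by (auto intro!: wspace_diff[OF r])
    qed
  qed
  have "\<forall>\<^sub>F ns in tuples (Suc k). wnorm K r (\<lambda>i. F ns i - u i) \<le> real (Suc k) powr (1 / r) * \<Lambda> + \<eta>"
    if \<eta>: "0 < \<eta>" for \<eta>
  proof -
    define b where "b = real k powr (1 / r) * \<Lambda>"
    have b: "0 \<le> b" using \<Lambda> by (simp add: b_def)
    \<comment> \<open>A positive \<open>t\<close> is sought whose errors fit into
      \<open>\<eta>\<close>. The absolute value makes the base nonnegative for all \<open>t\<close>,
      as \<open>tendsto_powr_nonneg\<close> demands.\<close>
    have lim: "((\<lambda>t. (\<Lambda> powr r + \<bar>b + t\<bar> powr r) powr (1 / r) + 2 * t)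
        \<longlongrightarrow> (\<Lambda> powr r + \<bar>b + 0\<bar> powr r) powr (1 / r) + 2 * 0) (at_right 0)"
      by (intro tendsto_intros tendsto_powr_nonneg) (use r in auto)
    have "\<Lambda> powr r + b powr r = real (Suc k) * \<Lambda> powr r"
      using r by (simp add: b_def powr_mult powr_powr distrib_right)
    then have eq: "(\<Lambda> powr r + b powr r) powr (1 / r) = real (Suc k) powr (1 / r) * \<Lambda>"
      using r \<Lambda> by (simp add: powr_mult powr_powr)
    have "\<forall>\<^sub>F t in at_right 0. (\<Lambda> powr r + \<bar>b + t\<bar> powr r) powr (1 / r) + 2 * t
        < real (Suc k) powr (1 / r) * \<Lambda> + \<eta>"
      by (rule order_tendstoD(2)[OF lim]) (use \<eta> b in \<open>simp add: eq\<close>)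
    moreover have "\<forall>\<^sub>F t in at_right (0::real). 0 < t" by (rule eventually_at_right_less)
    ultimately obtain t where t: "0 < t"
      "(\<Lambda> powr r + \<bar>b + t\<bar> powr r) powr (1 / r) + 2 * t < real (Suc k) powr (1 / r) * \<Lambda> + \<eta>"
      using eventually_happens[OF eventually_conj] by (metis (lifting) trivial_limit_at_right_real)
    have "\<forall>\<^sub>F ns in tuples k. wnorm K r (\<lambda>i. F (n # ns) i - u i) \<le> real (Suc k) powr (1 / r) * \<Lambda> + \<eta>" for n
    proof -
      have a: "(\<lambda>i. v n i - u i) \<in> wspace K r" by (intro wspace_diff r v uw)
      \<comment> \<open>\<open>N\<close> depends on \<open>n\<close> but not on \<open>ns\<close>,
        so the limit along \<open>tuples k\<close> can still clear the head below
        \<open>N\<close>.\<close>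
      obtain N where N: "wnorm K r (restr {N..} (\<lambda>i. v n i - u i)) \<le> t"
        using wnorm_tail_small[OF r a t(1)] by blast
      have "((\<lambda>ns. F (n # ns) i - v n i) \<longlongrightarrow> 0) (tuples k)" for i
        using tendsto_diff[OF v(2)[of n i] tendsto_const[of "v n i"]] by simp
      then have "\<forall>\<^sub>F ns in tuples k. wnorm K r (restr {..<N} (\<lambda>i. F (n # ns) i - v n i)) \<le> t"
        using t(1) by (intro eventually_wnorm_head_le[OF r])
      with v(3)[OF t(1), of n] eventually_tuples_length[of k] show ?thesis
      proof eventually_elim
        case (elim ns)
        have "wnorm K r (\<lambda>i. (v n i - u i) + (F (n # ns) i - v n i))
            \<le> (\<Lambda> powr r + (b + t) powr r) powr (1 / r) + 2 * t"
          by (rule wnorm_add_almost_disjoint[OF r a _ vu _ N])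
            (use elim Suc.prems(1)[of "n # ns"] v in \<open>auto intro!: wspace_diff[OF r] simp: b_def\<close>)
        also have "\<dots> \<le> real (Suc k) powr (1 / r) * \<Lambda> + \<eta>" using t b by simp
        finally show ?case by simp
      qed
    qed
    then show ?thesis by (simp add: eventually_tuples_Suc)
  qed
  then show ?case using u uw by blast
qed

end

section \<open>An equivalent norm with a lower estimate\<close>

definition hnorm :: "(nat \<Rightarrow> real) set \<Rightarrow> nat set \<Rightarrow> (nat \<Rightarrow> real) \<Rightarrow> (nat \<Rightarrow> nat \<Rightarrow> real) \<Rightarrow> real" where
  "hnorm K I ps y = (\<Sum>i\<in>I. wnorm K (ps i) (y i))"

definition hspace :: "(nat \<Rightarrow> real) set \<Rightarrow> nat set \<Rightarrow> (nat \<Rightarrow> real) \<Rightarrow> (nat \<Rightarrow> nat \<Rightarrow> real) set" where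
  "hspace K I ps = {y. \<forall>i\<in>I. y i \<in> wspace K (ps i)}"

definition rst :: "nat set \<Rightarrow> (nat \<Rightarrow> nat \<Rightarrow> real) \<Rightarrow> nat \<Rightarrow> nat \<Rightarrow> real" where
  "rst E y = (\<lambda>i. restr E (y i))"

text \<open>A \<open>q\<close>-variation over successive blocks. Blocks of a head and of a tail can
  be concatenated, which gives the lower estimate the constant 1; \<open>hnorm\<close> itself has it
  only up to a factor.\<close>

definition rmod :: "(nat \<Rightarrow> real) set \<Rightarrow> nat set \<Rightarrow> (nat \<Rightarrow> real) \<Rightarrow> real \<Rightarrow> (nat \<Rightarrow> nat \<Rightarrow> real) \<Rightarrow> real" where
  "rmod K I ps q y = (SUP Es\<in>{Es. sorted_wrt before Es}. \<Sum>E\<leftarrow>Es. hnorm K I ps (rst E y) powr q)"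

definition rho :: "(nat \<Rightarrow> real) set \<Rightarrow> nat set \<Rightarrow> (nat \<Rightarrow> real) \<Rightarrow> real \<Rightarrow> (nat \<Rightarrow> nat \<Rightarrow> real) \<Rightarrow> real" where
  "rho K I ps q y = rmod K I ps q y powr (1 / q)"

lemma rst_add: "rst E (\<lambda>i j. x i j + y i j) = (\<lambda>i j. rst E x i j + rst E y i j)"
  by (auto simp: rst_def restr_def fun_eq_iff)

lemma rst_rst: "rst A (rst B x) = rst (A \<inter> B) x"
  by (simp add: rst_def restr_restr)

text \<open>Describes the components with exponent below \<open>p\<close>; later \<open>q\<close> is
  placed strictly between the largest of these exponents and \<open>p\<close>.\<close>

locale lower_sum = tsirelson_weights +
  fixes I :: "nat set" and ps :: "nat \<Rightarrow> real" and q :: real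
  assumes finite_I: "finite I" and ps_ge: "i \<in> I \<Longrightarrow> 1 \<le> ps i" and ps_less: "i \<in> I \<Longrightarrow> ps i < q"
    and q_ge: "1 \<le> q"
begin

abbreviation H where "H \<equiv> hnorm K I ps"
abbreviation Y where "Y \<equiv> hspace K I ps"
abbreviation \<rho> where "\<rho> \<equiv> rho K I ps q"

lemma H_nonneg [simp]: "0 \<le> H y"
  by (simp add: hnorm_def sum_nonneg)

lemma Y_add: "x \<in> Y \<Longrightarrow> y \<in> Y \<Longrightarrow> (\<lambda>i j. x i j + y i j) \<in> Y"
  by (auto simp: hspace_def intro: wspace_add ps_ge)

lemma Y_diff: "x \<in> Y \<Longrightarrow> y \<in> Y \<Longrightarrow> (\<lambda>i j. x i j - y i j) \<in> Y"
  by (auto simp: hspace_def intro: wspace_diff ps_ge)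

lemma Y_scale: "x \<in> Y \<Longrightarrow> (\<lambda>i j. c * x i j) \<in> Y"
  by (auto simp: hspace_def intro: wspace_scale)

lemma Y_rst: "x \<in> Y \<Longrightarrow> rst E x \<in> Y"
  by (auto simp: hspace_def rst_def intro: wspace_restr ps_ge)

lemma H_triangle: "x \<in> Y \<Longrightarrow> y \<in> Y \<Longrightarrow> H (\<lambda>i j. x i j + y i j) \<le> H x + H y"
  unfolding hnorm_def sum.distrib[symmetric]
  by (intro sum_mono wnorm_triangle ps_ge) (auto simp: hspace_def)

lemma H_scale: "x \<in> Y \<Longrightarrow> H (\<lambda>i j. c * x i j) = \<bar>c\<bar> * H x"
  unfolding hnorm_def sum_distrib_left
  by (intro sum.cong refl wnorm_scale ps_ge) (auto simp: hspace_def)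

lemma H_tail_small:
  assumes "y \<in> Y" "0 < e"
  shows "\<exists>N. H (rst {N..} y) \<le> e"
proof -
  define d where "d = e / (card I + 1)"
  have d: "0 < d" using assms by (simp add: d_def)
  have "\<exists>N. \<forall>n\<ge>N. wnorm K (ps i) (restr {n..} (y i)) \<le> d" if "i \<in> I" for i
    using assms that d by (intro wnorm_tail_small ps_ge) (auto simp: hspace_def)
  then obtain N where N: "\<And>i n. i \<in> I \<Longrightarrow> N i \<le> n \<Longrightarrow> wnorm K (ps i) (restr {n..} (y i)) \<le> d"
    by metis
  have "H (rst {Max (N ` I)..} y) \<le> (\<Sum>i\<in>I. d)"
    unfolding hnorm_def rst_def using finite_I by (intro sum_mono N) auto
  also have "\<dots> \<le> e" using assms by (simp add: d_def field_simps)
  finally show ?thesis by blast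
qed

text \<open>The estimates of the components are added. By \<open>pow\<close>, the
  \<open>q\<close>-th power of the finite sum \<open>H\<close> is comparable to the sum of
  \<open>q\<close>-th powers, at the price of \<open>real (card I) powr q\<close>.\<close>

lemma H_lower_estimate:
  obtains C where "0 \<le> C" "\<And>y Es. y \<in> Y \<Longrightarrow> sorted_wrt before Es \<Longrightarrow>
    (\<Sum>E\<leftarrow>Es. H (rst E y) powr q) \<le> C * H y powr q"
proof -
  have "\<exists>C\<ge>0. \<forall>x\<in>wspace K (ps i). \<forall>Es. sorted_wrt before Es \<longrightarrow>
    (\<Sum>E\<leftarrow>Es. wnorm K (ps i) (restr E x) powr q) \<le> C * wnorm K (ps i) x powr q" if "i \<in> I" for i
    by (rule wnorm_lower_estimate[OF ps_ge[OF that] ps_less[OF that]]) blast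
  then obtain C where C: "\<And>i. i \<in> I \<Longrightarrow> 0 \<le> C i" "\<And>i x Es. i \<in> I \<Longrightarrow> x \<in> wspace K (ps i) \<Longrightarrow>
      sorted_wrt before Es \<Longrightarrow> (\<Sum>E\<leftarrow>Es. wnorm K (ps i) (restr E x) powr q) \<le> C i * wnorm K (ps i) x powr q"
    by metis
  have pow: "H z powr q \<le> real (card I) powr q * (\<Sum>i\<in>I. wnorm K (ps i) (z i) powr q)" for z
  proof -
    define S where "S = (\<Sum>i\<in>I. wnorm K (ps i) (z i) powr q)"
    have S: "0 \<le> S" by (simp add: S_def sum_nonneg)
    have "wnorm K (ps i) (z i) \<le> S powr (1 / q)" if "i \<in> I" for i
    proof (rule powr_le_powr_imp_le)
      have "wnorm K (ps i) (z i) powr q \<le> S"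
        unfolding S_def using that finite_I
        by (intro member_le_sum[where f = "\<lambda>i. wnorm K (ps i) (z i) powr q"]) auto
      then show "wnorm K (ps i) (z i) powr q \<le> (S powr (1 / q)) powr q"
        using q_ge S by (simp add: powr_powr)
    qed (use q_ge in auto)
    then have "H z \<le> (\<Sum>i\<in>I. S powr (1 / q))" unfolding hnorm_def by (intro sum_mono)
    then have "H z powr q \<le> (real (card I) * S powr (1 / q)) powr q"
      using q_ge by (intro powr_mono2) auto
    then show ?thesis using q_ge S by (simp add: powr_mult powr_powr S_def)
  qed
  show ?thesis
  proof
    show "0 \<le> real (card I) powr q * (\<Sum>i\<in>I. C i)" by (simp add: sum_nonneg C)
    fix y Es assume y: "y \<in> Y" and Es: "sorted_wrt before Es"
    have "(\<Sum>E\<leftarrow>Es. H (rst E y) powr q)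
        \<le> (\<Sum>E\<leftarrow>Es. real (card I) powr q * (\<Sum>i\<in>I. wnorm K (ps i) (rst E y i) powr q))"
      by (intro sum_list_mono pow)
    also have "\<dots> = real (card I) powr q * (\<Sum>i\<in>I. \<Sum>E\<leftarrow>Es. wnorm K (ps i) (restr E (y i)) powr q)"
      by (induction Es) (simp_all add: distrib_left sum.distrib rst_def)
    also have "\<dots> \<le> real (card I) powr q * (\<Sum>i\<in>I. C i * H y powr q)"
    proof (intro mult_left_mono sum_mono)
      fix i assume i: "i \<in> I"
      have "wnorm K (ps i) (y i) \<le> H y"
        unfolding hnorm_def using i finite_I
        by (intro member_le_sum[where f = "\<lambda>i. wnorm K (ps i) (y i)"]) auto
      then have "C i * wnorm K (ps i) (y i) powr q \<le> C i * H y powr q"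
        using C(1)[OF i] q_ge by (intro mult_left_mono powr_mono2) auto
      then show "(\<Sum>E\<leftarrow>Es. wnorm K (ps i) (restr E (y i)) powr q) \<le> C i * H y powr q"
        using C(2)[OF i _ Es, of "y i"] y i by (auto simp: hspace_def)
    qed simp
    finally show "(\<Sum>E\<leftarrow>Es. H (rst E y) powr q) \<le> real (card I) powr q * (\<Sum>i\<in>I. C i) * H y powr q"
      by (simp add: sum_distrib_right mult.assoc)
  qed
qed

section \<open>The renorming \<open>\<rho>\<close>: equivalence, norm properties, exact lower
  estimate\<close>

lemma sum_le_rmod:
  assumes "y \<in> Y" "sorted_wrt before Es"
  shows "(\<Sum>E\<leftarrow>Es. H (rst E y) powr q) \<le> rmod K I ps q y"
proof -
  obtain C where "\<And>Es. sorted_wrt before Es \<Longrightarrow> (\<Sum>E\<leftarrow>Es. H (rst E y) powr q) \<le> C * H y powr q"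
    using H_lower_estimate assms(1) by metis
  then show ?thesis
    unfolding rmod_def using assms
    by (intro cSUP_upper bdd_aboveI2[where M = "C * H y powr q"]) auto
qed

lemma rmod_least:
  assumes "\<And>Es. sorted_wrt before Es \<Longrightarrow> (\<Sum>E\<leftarrow>Es. H (rst E y) powr q) \<le> A"
  shows "rmod K I ps q y \<le> A"
  unfolding rmod_def by (rule cSUP_least) (use assms in \<open>auto intro: exI[of _ "[]"]\<close>)

lemma rmod_nonneg: "y \<in> Y \<Longrightarrow> 0 \<le> rmod K I ps q y"
  using sum_le_rmod[of y "[]"] by simp

lemma rho_nonneg [simp]: "0 \<le> \<rho> y"
  by (simp add: rho_def)

lemma rho_powr: "y \<in> Y \<Longrightarrow> \<rho> y powr q = rmod K I ps q y"
  using rmod_nonneg q_ge by (simp add: rho_def powr_powr)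

lemma rho_leI:
  assumes "y \<in> Y" "0 \<le> A" "\<And>Es. sorted_wrt before Es \<Longrightarrow> (\<Sum>E\<leftarrow>Es. H (rst E y) powr q) \<le> A powr q"
  shows "\<rho> y \<le> A"
proof (rule powr_le_powr_imp_le)
  show "\<rho> y powr q \<le> A powr q" unfolding rho_powr[OF assms(1)] by (rule rmod_least) (rule assms)
qed (use q_ge assms in auto)

lemma sum_le_of_rho_le:
  assumes "y \<in> Y" "\<rho> y \<le> A" "sorted_wrt before Es"
  shows "(\<Sum>E\<leftarrow>Es. H (rst E y) powr q) \<le> A powr q"
proof -
  have "(\<Sum>E\<leftarrow>Es. H (rst E y) powr q) \<le> \<rho> y powr q"
    using sum_le_rmod[OF assms(1,3)] rho_powr[OF assms(1)] by simp
  also have "\<dots> \<le> A powr q" using assms q_ge by (intro powr_mono2) auto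
  finally show ?thesis .
qed

lemma H_le_rho: "y \<in> Y \<Longrightarrow> H y \<le> \<rho> y"
proof (rule powr_le_powr_imp_le)
  assume "y \<in> Y"
  moreover have "rst UNIV y = y" by (simp add: rst_def restr_def)
  ultimately show "H y powr q \<le> \<rho> y powr q"
    using sum_le_of_rho_le[of y "\<rho> y" "[UNIV]"] by simp
qed (use q_ge in auto)

lemma rho_le_H:
  obtains C where "0 < C" "\<And>y. y \<in> Y \<Longrightarrow> \<rho> y \<le> C * H y"
proof -
  obtain C where C: "0 \<le> C" "\<And>y Es. y \<in> Y \<Longrightarrow> sorted_wrt before Es \<Longrightarrow>
      (\<Sum>E\<leftarrow>Es. H (rst E y) powr q) \<le> C * H y powr q"
    by (rule H_lower_estimate) blast
  have *: "\<rho> y \<le> (C + 1) powr (1 / q) * H y" if "y \<in> Y" for y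
  proof (rule rho_leI[OF that])
    fix Es assume "sorted_wrt before Es"
    then have "(\<Sum>E\<leftarrow>Es. H (rst E y) powr q) \<le> C * H y powr q" using C that by blast
    also have "\<dots> \<le> (C + 1) * H y powr q" by (simp add: distrib_right)
    finally show "(\<Sum>E\<leftarrow>Es. H (rst E y) powr q) \<le> ((C + 1) powr (1 / q) * H y) powr q"
      using q_ge C by (simp add: powr_mult powr_powr)
  qed (use C in simp)
  show ?thesis by (rule that[OF _ *]) (use C in auto)
qed

text \<open>The argument of \<open>wsum_add_le\<close>, with the blocks of a list in place of
  coordinates.\<close>

lemma rho_triangle_pos:
  assumes x: "x \<in> Y" and y: "y \<in> Y" and A: "\<rho> x \<le> A" "0 < A" and B: "\<rho> y \<le> B" "0 < B"
  shows "\<rho> (\<lambda>i j. x i j + y i j) \<le> A + B"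
proof (rule rho_leI[OF Y_add[OF x y]])
  fix Es assume Es: "sorted_wrt before Es"
  have "H (rst E (\<lambda>i j. x i j + y i j)) powr q \<le> (H (rst E x) + H (rst E y)) powr q" for E
    using q_ge H_triangle[OF Y_rst[OF x] Y_rst[OF y], of E E]
    by (intro powr_mono2) (auto simp: rst_add)
  also have "(H (rst E x) + H (rst E y)) powr q \<le> (A + B) powr q *
      (A / (A + B) * (H (rst E x) / A) powr q + B / (A + B) * (H (rst E y) / B) powr q)" for E
    using q_ge A B by (intro powr_add_le_convex) auto
  finally have *: "H (rst E (\<lambda>i j. x i j + y i j)) powr q \<le> (A + B) powr q *
      (A / (A + B) / A powr q * H (rst E x) powr q + B / (A + B) / B powr q * H (rst E y) powr q)" for E
    using A B by (simp add: powr_divide)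
  have "(\<Sum>E\<leftarrow>Es. H (rst E (\<lambda>i j. x i j + y i j)) powr q) \<le> (\<Sum>E\<leftarrow>Es. (A + B) powr q *
      (A / (A + B) / A powr q * H (rst E x) powr q + B / (A + B) / B powr q * H (rst E y) powr q))"
    by (intro sum_list_mono *)
  also have "\<dots> = (A + B) powr q * (A / (A + B) / A powr q * (\<Sum>E\<leftarrow>Es. H (rst E x) powr q)
      + B / (A + B) / B powr q * (\<Sum>E\<leftarrow>Es. H (rst E y) powr q))"
    by (simp only: sum_list_const_mult sum_list_addf)
  also have "\<dots> \<le> (A + B) powr q * (A / (A + B) / A powr q * A powr q + B / (A + B) / B powr q * B powr q)"
    by (intro mult_left_mono add_mono sum_le_of_rho_le) (use x y Es A B in auto)
  also have "\<dots> = (A + B) powr q" using A B by (simp flip: add_divide_distrib)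
  finally show "(\<Sum>E\<leftarrow>Es. H (rst E (\<lambda>i j. x i j + y i j)) powr q) \<le> (A + B) powr q" .
qed (use A B in simp)

lemma rho_triangle:
  assumes x: "x \<in> Y" and y: "y \<in> Y"
  shows "\<rho> (\<lambda>i j. x i j + y i j) \<le> \<rho> x + \<rho> y"
proof (rule field_le_epsilon)
  fix e :: real assume "0 < e"
  then show "\<rho> (\<lambda>i j. x i j + y i j) \<le> \<rho> x + \<rho> y + e"
    using rho_triangle_pos[OF x y, of "\<rho> x + e/2" "\<rho> y + e/2"] by (simp add: add_nonneg_pos)
qed

lemma rho_scale:
  assumes "x \<in> Y"
  shows "\<rho> (\<lambda>i j. c * x i j) = \<bar>c\<bar> * \<rho> x"
proof -
  have le: "\<rho> (\<lambda>i j. c * x i j) \<le> \<bar>c\<bar> * \<rho> x" if x: "x \<in> Y" for x c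
  proof (rule rho_leI[OF Y_scale[OF x]])
    fix Es assume Es: "sorted_wrt before Es"
    have "rst E (\<lambda>i j. c * x i j) = (\<lambda>i j. c * rst E x i j)" for E
      by (auto simp: rst_def restr_def fun_eq_iff)
    then have "(\<Sum>E\<leftarrow>Es. H (rst E (\<lambda>i j. c * x i j)) powr q) = \<bar>c\<bar> powr q * (\<Sum>E\<leftarrow>Es. H (rst E x) powr q)"
      by (simp add: H_scale Y_rst x powr_mult sum_list_const_mult)
    also have "\<dots> \<le> \<bar>c\<bar> powr q * \<rho> x powr q"
      by (intro mult_left_mono sum_le_of_rho_le x Es) auto
    finally show "(\<Sum>E\<leftarrow>Es. H (rst E (\<lambda>i j. c * x i j)) powr q) \<le> (\<bar>c\<bar> * \<rho> x) powr q"
      by (simp add: powr_mult)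
  qed simp
  show ?thesis
  proof (cases "c = 0")
    case True
    then show ?thesis using le[OF assms, of 0] by (simp add: order_antisym)
  next
    case False
    have "\<rho> x \<le> \<bar>inverse c\<bar> * \<rho> (\<lambda>i j. c * x i j)"
      using le[OF Y_scale[OF assms, of c], of "inverse c"] False by (simp flip: mult.assoc)
    then have "\<bar>c\<bar> * \<rho> x \<le> \<rho> (\<lambda>i j. c * x i j)"
      using False by (simp add: field_simps abs_inverse)
    then show ?thesis using le[OF assms, of c] by linarith
  qed
qed

lemma rho_triangle_diff:
  assumes "x \<in> Y" "y \<in> Y"
  shows "\<rho> (\<lambda>i j. x i j - y i j) \<le> \<rho> x + \<rho> y"
  using rho_triangle[OF assms(1) Y_scale[OF assms(2), of "-1"]] rho_scale[OF assms(2), of "-1"] by simp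

text \<open>Blocks cut to the head followed by blocks cut to the tail again form a successive list.
  The constant 1 is essential for comparing nearly equal quantities in the midpoint
  argument.\<close>

lemma rho_head_tail:
  assumes y: "y \<in> Y"
  shows "\<rho> (rst {..<N} y) powr q + \<rho> (rst {N..} y) powr q \<le> \<rho> y powr q"
proof -
  have *: "(\<Sum>E\<leftarrow>Es. H (rst E (rst {..<N} y)) powr q) + (\<Sum>E\<leftarrow>Fs. H (rst E (rst {N..} y)) powr q) \<le> rmod K I ps q y"
    if "sorted_wrt before Es" "sorted_wrt before Fs" for Es Fs
  proof -
    let ?Gs = "map (\<lambda>E. E \<inter> {..<N}) Es @ map (\<lambda>E. E \<inter> {N..}) Fs"
    have "sorted_wrt before ?Gs"
      using that sorted_wrt_before_Int[of Es "{..<N}"] sorted_wrt_before_Int[of Fs "{N..}"]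
      by (auto simp: sorted_wrt_append before_def)
    from sum_le_rmod[OF y this] show ?thesis by (simp add: rst_rst comp_def)
  qed
  \<comment> \<open>The suprema are taken one after the other: over the tail blocks with
    \<open>Es\<close> fixed, then over \<open>Es\<close>.\<close>
  have "(\<Sum>E\<leftarrow>Es. H (rst E (rst {..<N} y)) powr q) \<le> rmod K I ps q y - rmod K I ps q (rst {N..} y)"
    if "sorted_wrt before Es" for Es
  proof -
    have "rmod K I ps q (rst {N..} y) \<le> rmod K I ps q y - (\<Sum>E\<leftarrow>Es. H (rst E (rst {..<N} y)) powr q)"
      by (rule rmod_least) (use *[OF that] in \<open>auto simp: le_diff_eq add.commute\<close>)
    then show ?thesis by simp
  qed
  then have "rmod K I ps q (rst {..<N} y) \<le> rmod K I ps q y - rmod K I ps q (rst {N..} y)"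
    by (rule rmod_least)
  then show ?thesis using y by (simp add: rho_powr Y_rst)
qed

lemma rho_tail_small:
  assumes "y \<in> Y" "0 < e"
  shows "\<exists>N. \<rho> (rst {N..} y) \<le> e"
proof -
  obtain C where C: "0 < C" "\<And>y. y \<in> Y \<Longrightarrow> \<rho> y \<le> C * H y" by (rule rho_le_H) blast
  obtain N where "H (rst {N..} y) \<le> e / C" using H_tail_small[OF assms(1)] assms(2) C by fastforce
  then have "C * H (rst {N..} y) \<le> e" using C by (simp add: field_simps)
  then show ?thesis using C(2)[OF Y_rst[OF assms(1)], of "{N..}"] order_trans by blast
qed

text \<open>The tail of an approximate midpoint is small: \<open>v\<close> is the displacement from the true midpoint of the
  segment from \<open>- w\<close> to \<open>w\<close>, and one of the two heads \<open>v \<plusminus> w\<close> is at least as large as the head of \<open>w\<close>.\<close>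

lemma rho_midpoint_tail:
  assumes v: "v \<in> Y" and w: "w \<in> Y"
    and P: "\<rho> (\<lambda>i j. v i j - w i j) \<le> P" "\<rho> (\<lambda>i j. v i j + w i j) \<le> P"
    and e: "\<rho> (rst {N..} w) \<le> e"
  shows "\<rho> (rst {N..} v) powr q \<le> (P + e) powr q - (max 0 (\<rho> w - e)) powr q"
proof -
  define w' where "w' = rst {..<N} w"
  \<comment> \<open>Shifting \<open>v\<close> by the head of \<open>w\<close> alone leaves the tails
    of \<open>a\<close> and \<open>b\<close> equal to that of \<open>v\<close>.\<close>
  define a where "a = (\<lambda>i j. v i j + w' i j)"
  define b where "b = (\<lambda>i j. v i j - w' i j)"
  have [simp]: "w' \<in> Y" "a \<in> Y" "b \<in> Y" using v w by (simp_all add: w'_def a_def b_def Y_add Y_diff Y_rst)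
  have wsplit: "w = (\<lambda>i j. w' i j + rst {N..} w i j)"
    by (auto simp: w'_def rst_def restr_def fun_eq_iff)
  have "a = (\<lambda>i j. (v i j + w i j) - rst {N..} w i j)" "b = (\<lambda>i j. (v i j - w i j) + rst {N..} w i j)"
    by (auto simp: a_def b_def w'_def rst_def restr_def fun_eq_iff)
  then have ab: "\<rho> a \<le> P + e" "\<rho> b \<le> P + e"
    using rho_triangle_diff[OF Y_add[OF v w] Y_rst[OF w], of "{N..}"]
      rho_triangle[OF Y_diff[OF v w] Y_rst[OF w], of "{N..}"] P e by auto
  have "\<rho> w \<le> \<rho> w' + e"
    using rho_triangle[OF _ Y_rst[OF w], of w' "{N..}"] e wsplit by simp
  then have w'_ge: "max 0 (\<rho> w - e) \<le> \<rho> w'" by simp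
  have rr: "rst {N..} a = rst {N..} v" "rst {N..} b = rst {N..} v"
    by (auto simp: a_def b_def w'_def rst_def restr_def fun_eq_iff)
  have "(\<lambda>i j. 2 * w' i j) = (\<lambda>i j. rst {..<N} a i j - rst {..<N} b i j)"
    by (auto simp: a_def b_def w'_def rst_def restr_def fun_eq_iff)
  then have "2 * \<rho> w' \<le> \<rho> (rst {..<N} a) + \<rho> (rst {..<N} b)"
    using rho_triangle_diff[of "rst {..<N} a" "rst {..<N} b"] rho_scale[of w' 2] by (simp add: Y_rst)
  then consider "\<rho> w' \<le> \<rho> (rst {..<N} a)" | "\<rho> w' \<le> \<rho> (rst {..<N} b)" by linarith
  then have "\<exists>c\<in>Y. \<rho> w' \<le> \<rho> (rst {..<N} c) \<and> rst {N..} c = rst {N..} v \<and> \<rho> c \<le> P + e"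
    using ab rr by cases auto
  then obtain c where c: "c \<in> Y" "\<rho> w' \<le> \<rho> (rst {..<N} c)" "rst {N..} c = rst {N..} v" "\<rho> c \<le> P + e" by blast
  have "(max 0 (\<rho> w - e)) powr q \<le> \<rho> (rst {..<N} c) powr q"
    using w'_ge c q_ge by (intro powr_mono2) auto
  moreover have "\<rho> c powr q \<le> (P + e) powr q" using c q_ge by (intro powr_mono2) auto
  ultimately show ?thesis using rho_head_tail[OF c(1), of N] c(3) by simp
qed

end

section \<open>Collapsing the components with smaller exponent\<close>

context tsirelson_weights begin

lemma wnorm_add_spread:
  assumes "1 \<le> p" "h \<in> wspace K p" "0 < e"
  obtains N where "\<And>u. u \<in> wspace K p \<Longrightarrow> (\<And>j. j < N \<Longrightarrow> u j = 0) \<Longrightarrow> wnorm K p u \<le> \<tau> \<Longrightarrow>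
    wnorm K p (\<lambda>j. h j + u j) \<le> (wnorm K p h powr p + \<tau> powr p) powr (1 / p) + e"
proof -
  obtain N where N: "wnorm K p (restr {N..} h) \<le> e / 2"
    using wnorm_tail_small[OF assms(1,2), of "e / 2"] assms(3) by auto
  show ?thesis
  proof
    fix u assume u: "u \<in> wspace K p" "\<And>j. j < N \<Longrightarrow> u j = 0" "wnorm K p u \<le> \<tau>"
    have "restr {..<N} u = (\<lambda>j. 0)" using u(2) by (auto simp: restr_def)
    then show "wnorm K p (\<lambda>j. h j + u j) \<le> (wnorm K p h powr p + \<tau> powr p) powr (1 / p) + e"
      using wnorm_add_almost_disjoint[OF assms(1,2) u(1) order_refl u(3) N] assms(3) by simp
  qed
qed

end

text \<open>Here \<open>s\<close> is an asymptotic slope, \<open>l\<close> the ratio of the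
  perturbation to the half-distance, and \<open>\<kappa>\<close> a tolerance. For
  \<open>\<kappa> = 0\<close> the left side is at most \<open>s powr q * l powr p\<close>, which for
  small \<open>l\<close> is below \<open>(\<epsilon> * l) powr q\<close> because
  \<open>q < p\<close>. With \<open>l\<close> fixed, continuity supplies
  \<open>\<kappa>\<close>.\<close>

lemma midpoint_parameters:
  fixes s \<epsilon> p q :: real
  assumes "0 \<le> s" "0 < \<epsilon>" "1 \<le> q" "q < p"
  obtains l \<kappa> where "0 < l" "l \<le> 1/2" "0 < \<kappa>"
    "((s + \<kappa>) * ((1 + l powr p) powr (1 / p) + \<kappa>) + \<kappa>) powr q - (max 0 (s - 2 * \<kappa>)) powr q \<le> (\<epsilon> * l) powr q"
proof -
  have "((\<lambda>l. s powr q * \<bar>l\<bar> powr (p - q)) \<longlongrightarrow> s powr q * \<bar>0\<bar> powr (p - q)) (at_right 0)"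
    by (intro tendsto_intros tendsto_powr_nonneg) (use assms in auto)
  then have "\<forall>\<^sub>F l in at_right 0. s powr q * \<bar>l\<bar> powr (p - q) < \<epsilon> powr q"
    by (rule order_tendstoD) (use assms in auto)
  moreover have "\<forall>\<^sub>F l in at_right (0::real). l < 1/2 \<and> 0 < l"
    using eventually_at_right_real[of 0 "1/2 :: real"] by (simp add: conj_commute)
  ultimately have "\<exists>l. s powr q * \<bar>l\<bar> powr (p - q) < \<epsilon> powr q \<and> (l < 1/2 \<and> 0 < l)"
    by (rule eventually_happens'[OF trivial_limit_at_right_real eventually_conj])
  then obtain l where l: "s powr q * l powr (p - q) < \<epsilon> powr q" "0 < l" "l < 1/2" by auto
  define g where "g = (1 + l powr p) powr (1 / p)"
  have "g powr q = (1 + l powr p) powr (q / p)"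
    by (simp add: g_def powr_powr)
  also have "\<dots> \<le> (1 + l powr p) powr 1" using assms by (intro powr_mono) auto
  finally have g: "g powr q \<le> 1 + l powr p" by (simp add: add_nonneg_nonneg)
  have "(s * g) powr q - s powr q = s powr q * (g powr q - 1)"
    using assms by (simp add: powr_mult g_def algebra_simps)
  also have "\<dots> \<le> s powr q * l powr p" using g by (intro mult_left_mono) auto
  also have "\<dots> = (s powr q * l powr (p - q)) * l powr q" using l by (simp flip: powr_add)
  also have "\<dots> < \<epsilon> powr q * l powr q" using l by (intro mult_strict_right_mono) auto
  also have "\<dots> = (\<epsilon> * l) powr q" using l assms by (simp add: powr_mult)
  finally have less: "(s * g) powr q - s powr q < (\<epsilon> * l) powr q" .
  have "((\<lambda>\<kappa>. \<bar>(s + \<kappa>) * (g + \<kappa>) + \<kappa>\<bar> powr q - (max 0 (s - 2 * \<kappa>)) powr q)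
      \<longlongrightarrow> \<bar>(s + 0) * (g + 0) + 0\<bar> powr q - (max 0 (s - 2 * 0)) powr q) (at_right 0)"
    by (intro tendsto_intros tendsto_powr_nonneg tendsto_max) (use assms in auto)
  then have "\<forall>\<^sub>F \<kappa> in at_right 0. \<bar>(s + \<kappa>) * (g + \<kappa>) + \<kappa>\<bar> powr q - (max 0 (s - 2 * \<kappa>)) powr q < (\<epsilon> * l) powr q"
    by (rule order_tendstoD) (use assms less in \<open>auto simp: g_def\<close>)
  then have "\<exists>\<kappa>. \<bar>(s + \<kappa>) * (g + \<kappa>) + \<kappa>\<bar> powr q - (max 0 (s - 2 * \<kappa>)) powr q < (\<epsilon> * l) powr q \<and> 0 < \<kappa>"
    by (rule eventually_happens'[OF trivial_limit_at_right_real eventually_conj[OF _ eventually_at_right_less]])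
  then obtain \<kappa> where \<kappa>: "\<bar>(s + \<kappa>) * (g + \<kappa>) + \<kappa>\<bar> powr q - (max 0 (s - 2 * \<kappa>)) powr q < (\<epsilon> * l) powr q" "0 < \<kappa>"
    by blast
  have "0 \<le> (s + \<kappa>) * (g + \<kappa>) + \<kappa>" using assms \<kappa> by (simp add: g_def)
  then show ?thesis using that[of l \<kappa>] l \<kappa> by (simp add: g_def)
qed

context lower_sum begin

text \<open>\<open>s\<close> is the infimum of the slopes valid beyond some threshold distance; it
  may be zero.\<close>

lemma ex_asymptotic_slope:
  assumes "tsirelson_weights K0" "1 \<le> p"
    and g: "\<And>x. x \<in> wspace K0 p \<Longrightarrow> g x \<in> Y"
    and Lip: "\<And>x y. x \<in> wspace K0 p \<Longrightarrow> y \<in> wspace K0 p \<Longrightarrow>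
      \<rho> (\<lambda>i j. g x i j - g y i j) \<le> L * wdist K0 p x y + L"
  obtains s where "0 \<le> s"
    "\<And>S. s < S \<Longrightarrow> \<exists>\<theta>>0. \<forall>x\<in>wspace K0 p. \<forall>y\<in>wspace K0 p. \<theta> \<le> wdist K0 p x y \<longrightarrow>
      \<rho> (\<lambda>i j. g x i j - g y i j) \<le> S * wdist K0 p x y"
    "\<And>S \<theta>. S < s \<Longrightarrow> \<exists>x\<in>wspace K0 p. \<exists>y\<in>wspace K0 p. \<theta> \<le> wdist K0 p x y \<and>
      S * wdist K0 p x y < \<rho> (\<lambda>i j. g x i j - g y i j)"
proof -
  interpret D: tsirelson_weights K0 by fact
  define Q where "Q = (\<lambda>S \<theta>. \<forall>x\<in>wspace K0 p. \<forall>y\<in>wspace K0 p. \<theta> \<le> wdist K0 p x y \<longrightarrow>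
      \<rho> (\<lambda>i j. g x i j - g y i j) \<le> S * wdist K0 p x y)"
  define A where "A = {S. \<exists>\<theta>>0. Q S \<theta>}"
  define s where "s = Inf A"
  have L: "0 \<le> L" using Lip[of "\<lambda>_. 0" "\<lambda>_. 0"] rho_nonneg
    by (simp add: wdist_def) (meson order_trans rho_nonneg)
  \<comment> \<open>At distances at least 1 the additive constant is absorbed into the
    slope.\<close>
  have "Q (L + L) 1"
    unfolding Q_def
  proof (intro ballI impI)
    fix x y assume xy: "x \<in> wspace K0 p" "y \<in> wspace K0 p" "1 \<le> wdist K0 p x y"
    have "L * 1 \<le> L * wdist K0 p x y" using xy L by (intro mult_left_mono)
    then show "\<rho> (\<lambda>i j. g x i j - g y i j) \<le> (L + L) * wdist K0 p x y"
      using Lip[OF xy(1,2)] by (simp add: distrib_right)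
  qed
  then have ne: "A \<noteq> {}" unfolding A_def using zero_less_one by blast
  \<comment> \<open>Pairs at arbitrarily large distance exist, which rules out negative slopes and
    bounds \<open>A\<close> below.\<close>
  have big: "\<exists>x\<in>wspace K0 p. \<exists>y\<in>wspace K0 p. \<theta> \<le> wdist K0 p x y \<and> 0 < wdist K0 p x y" for \<theta>
  proof -
    define x where "x = (\<lambda>i. max \<theta> 1 * indicator {0::nat} i)"
    have x: "x \<in> wspace K0 p" unfolding x_def by (intro D.wspace_scale D.wspace_indicator) simp
    have "max \<theta> 1 \<le> wdist K0 p x (\<lambda>_. 0)"
      using D.abs_coord_le_wnorm[OF assms(2) x, of 0] by (simp add: wdist_def x_def)
    then show ?thesis using x by (intro bexI[of _ x] bexI[of _ "\<lambda>_. 0"]) auto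
  qed
  have A0: "0 \<le> S" if "S \<in> A" for S
  proof -
    obtain \<theta> where "Q S \<theta>" using \<open>S \<in> A\<close> by (auto simp: A_def)
    moreover obtain x y where xy: "x \<in> wspace K0 p" "y \<in> wspace K0 p" "\<theta> \<le> wdist K0 p x y" "0 < wdist K0 p x y"
      using big by blast
    ultimately have "0 \<le> S * wdist K0 p x y"
      unfolding Q_def by (meson order_trans rho_nonneg)
    then show ?thesis using xy by (simp add: zero_le_mult_iff)
  qed
  then have bdd: "bdd_below A" by (rule bdd_belowI)
  show ?thesis
  proof
    show "0 \<le> s" unfolding s_def using ne A0 by (intro cInf_greatest) auto
    fix S
    {
      assume "s < S"
      then obtain S' where S': "S' \<in> A" "S' < S" unfolding s_def using cInf_lessD[OF ne] by blast
      then obtain \<theta> where \<theta>: "0 < \<theta>" "Q S' \<theta>" by (auto simp: A_def)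
      have "Q S \<theta>"
        unfolding Q_def
      proof (intro ballI impI)
        fix x y assume xy: "x \<in> wspace K0 p" "y \<in> wspace K0 p" "\<theta> \<le> wdist K0 p x y"
        have "\<rho> (\<lambda>i j. g x i j - g y i j) \<le> S' * wdist K0 p x y" using \<theta> xy by (auto simp: Q_def)
        also have "\<dots> \<le> S * wdist K0 p x y" using S' by (intro mult_right_mono) (auto simp: wdist_def)
        finally show "\<rho> (\<lambda>i j. g x i j - g y i j) \<le> S * wdist K0 p x y" .
      qed
      then show "\<exists>\<theta>>0. \<forall>x\<in>wspace K0 p. \<forall>y\<in>wspace K0 p. \<theta> \<le> wdist K0 p x y \<longrightarrow>
          \<rho> (\<lambda>i j. g x i j - g y i j) \<le> S * wdist K0 p x y"
        using \<theta>(1) unfolding Q_def by blast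
    }
    fix \<theta> assume "S < s"
    then have "S \<notin> A" unfolding s_def using cInf_lower[OF _ bdd] by force
    then have "\<not> Q S (max \<theta> 1)" unfolding A_def by auto
    then show "\<exists>x\<in>wspace K0 p. \<exists>y\<in>wspace K0 p. \<theta> \<le> wdist K0 p x y \<and>
        S * wdist K0 p x y < \<rho> (\<lambda>i j. g x i j - g y i j)"
      unfolding Q_def by (auto simp: not_le)
  qed
qed

text \<open>Every coordinate is bounded and so converges along the ultrafilter; the head has
  finitely many coordinates in finitely many components.\<close>

lemma tuples_head_converge:
  assumes "\<And>ns. length ns = k \<Longrightarrow> F ns \<in> Y" "\<And>ns i. length ns = k \<Longrightarrow> i \<in> I \<Longrightarrow> wnorm K (ps i) (F ns i) \<le> B" "0 < e"
  obtains c where "\<forall>\<^sub>F ns in tuples k. H (rst {..<N} (\<lambda>i j. F ns i j - c i j)) \<le> e"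
proof -
  have len: "\<forall>\<^sub>F ns in tuples k. length ns = k" by (rule eventually_tuples_length)
  have "\<exists>l. ((\<lambda>ns. F ns i j) \<longlongrightarrow> l) (tuples k)" if i: "i \<in> I" for i j
  proof (rule is_ultra_bounded_convergent[OF is_ultra_tuples])
    show "\<forall>\<^sub>F ns in tuples k. \<bar>F ns i j\<bar> \<le> B"
      using len
    proof eventually_elim
      case (elim ns)
      show ?case
        using abs_coord_le_wnorm[OF ps_ge[OF i], of "F ns i" j] assms(1)[OF elim] assms(2)[OF elim i] i
        by (force simp: hspace_def)
    qed
  qed
  then obtain c where c: "\<And>i j. i \<in> I \<Longrightarrow> ((\<lambda>ns. F ns i j) \<longlongrightarrow> c i j) (tuples k)" by metis
  define d where "d = e / (card I + 1)"
  have d: "0 < d" using assms by (simp add: d_def)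
  have "\<forall>\<^sub>F ns in tuples k. wnorm K (ps i) (restr {..<N} (\<lambda>j. F ns i j - c i j)) \<le> d" if i: "i \<in> I" for i
  proof (rule eventually_wnorm_head_le[OF ps_ge[OF i] _ d])
    show "((\<lambda>ns. F ns i j - c i j) \<longlongrightarrow> 0) (tuples k)" for j
      using tendsto_diff[OF c[OF i, of j] tendsto_const[of "c i j"]] by simp
  qed
  then have "\<forall>\<^sub>F ns in tuples k. \<forall>i\<in>I. wnorm K (ps i) (restr {..<N} (\<lambda>j. F ns i j - c i j)) \<le> d"
    using finite_I by (simp add: eventually_ball_finite)
  then have "\<forall>\<^sub>F ns in tuples k. H (rst {..<N} (\<lambda>i j. F ns i j - c i j)) \<le> e"
  proof eventually_elim
    case (elim ns)
    have "H (rst {..<N} (\<lambda>i j. F ns i j - c i j)) \<le> (\<Sum>i\<in>I. d)"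
      unfolding hnorm_def rst_def using elim by (intro sum_mono) auto
    also have "\<dots> \<le> e" using assms by (simp add: d_def field_simps)
    finally show ?case .
  qed
  then show ?thesis using that by blast
qed

end

context lower_sum begin

text \<open>The points \<open>x + u\<close> with \<open>u\<close> spread out far to the right and \<open>\<parallel>u\<parallel> \<le> \<tau>\<close> are approximate midpoints of a
  pair that nearly attains the asymptotic slope, so their images have small tails. The smallness
  relative to \<open>\<tau>\<close> comes from \<open>q < p\<close>.\<close>

lemma tuples_collapse:
  assumes D: "tsirelson_weights K0" and p: "q < p"
    and g: "\<And>x. x \<in> wspace K0 p \<Longrightarrow> g x \<in> Y"
    and Lip: "\<And>x y. x \<in> wspace K0 p \<Longrightarrow> y \<in> wspace K0 p \<Longrightarrow>
      H (\<lambda>i j. g x i j - g y i j) \<le> L * wdist K0 p x y + L"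
    and \<epsilon>: "0 < \<epsilon>" and k: "0 < k" and \<tau>0: "0 < \<tau>0"
  obtains \<tau> x c where "\<tau>0 \<le> \<tau>" "x \<in> wspace K0 p" "c \<in> Y"
    "\<forall>\<^sub>F ns in tuples k. H (\<lambda>i j. g (\<lambda>m. x m + \<tau> * real k powr (- 1 / p) * indicator (set ns) m) i j - c i j) \<le> \<epsilon> * \<tau>"
proof -
  interpret D: tsirelson_weights K0 by fact
  have p1: "1 \<le> p" using p q_ge by simp
  obtain C where C: "0 < C" "\<And>y. y \<in> Y \<Longrightarrow> \<rho> y \<le> C * H y" by (rule rho_le_H) blast
  have "\<rho> (\<lambda>i j. g x i j - g y i j) \<le> (C * L) * wdist K0 p x y + C * L"
    if "x \<in> wspace K0 p" "y \<in> wspace K0 p" for x y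
  proof -
    have "\<rho> (\<lambda>i j. g x i j - g y i j) \<le> C * H (\<lambda>i j. g x i j - g y i j)"
      using that by (intro C Y_diff g)
    also have "\<dots> \<le> C * (L * wdist K0 p x y + L)"
      using C that by (intro mult_left_mono Lip) auto
    finally show ?thesis by (simp add: algebra_simps)
  qed
  from ex_asymptotic_slope[OF D p1 g this]
  obtain s where s: "0 \<le> s"
    "\<And>S. s < S \<Longrightarrow> \<exists>\<theta>>0. \<forall>x\<in>wspace K0 p. \<forall>y\<in>wspace K0 p. \<theta> \<le> wdist K0 p x y \<longrightarrow>
      \<rho> (\<lambda>i j. g x i j - g y i j) \<le> S * wdist K0 p x y"
    "\<And>S \<theta>. S < s \<Longrightarrow> \<exists>x\<in>wspace K0 p. \<exists>y\<in>wspace K0 p. \<theta> \<le> wdist K0 p x y \<and>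
      S * wdist K0 p x y < \<rho> (\<lambda>i j. g x i j - g y i j)" by blast
  \<comment> \<open>Half of \<open>\<epsilon>\<close> is spent on tails, the other half on
    heads.\<close>
  obtain l \<kappa> where l: "0 < l" "l \<le> 1/2" and \<kappa>: "0 < \<kappa>"
    and par: "((s + \<kappa>) * ((1 + l powr p) powr (1 / p) + \<kappa>) + \<kappa>) powr q - (max 0 (s - 2 * \<kappa>)) powr q
      \<le> (\<epsilon> / 2 * l) powr q"
    using midpoint_parameters[OF s(1), of "\<epsilon> / 2" q p] \<epsilon> q_ge p by auto
  obtain \<theta> where \<theta>: "0 < \<theta>" "\<And>x y. x \<in> wspace K0 p \<Longrightarrow> y \<in> wspace K0 p \<Longrightarrow> \<theta> \<le> wdist K0 p x y \<Longrightarrow>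
      \<rho> (\<lambda>i j. g x i j - g y i j) \<le> (s + \<kappa>) * wdist K0 p x y"
    using s(2)[of "s + \<kappa>"] \<kappa> by auto
  \<comment> \<open>With half-distance \<open>R\<close>, the bound \<open>4 * \<theta>\<close> gives
    \<open>R \<ge> 2 * \<theta>\<close>; as \<open>\<tau> = l * R \<le> R / 2\<close>, the perturbed
    midpoints stay at distance \<open>\<theta>\<close> from both ends. The bound
    \<open>2 * \<tau>0 / l\<close> yields \<open>\<tau> \<ge> \<tau>0\<close>.\<close>
  obtain y1 y2 where y: "y1 \<in> wspace K0 p" "y2 \<in> wspace K0 p" "max (4 * \<theta>) (2 * \<tau>0 / l) \<le> wdist K0 p y1 y2"
    "(s - \<kappa>) * wdist K0 p y1 y2 < \<rho> (\<lambda>i j. g y1 i j - g y2 i j)"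
    using s(3)[of "s - \<kappa>" "max (4 * \<theta>) (2 * \<tau>0 / l)"] \<kappa> by auto
  define R where "R = wdist K0 p y1 y2 / 2"
  have R: "2 * \<theta> \<le> R" "\<tau>0 / l \<le> R" using y(3) by (simp_all add: R_def mult.commute)
  have R0: "0 < R" using R \<theta> by simp
  define \<tau> where "\<tau> = l * R"
  have \<tau>: "\<tau>0 \<le> \<tau>" using R l by (simp add: \<tau>_def field_simps)
  have \<tau>R: "\<tau> \<le> R / 2" using l R0 by (simp add: \<tau>_def)
  define x where "x = (\<lambda>m. (1/2) * (y1 m + y2 m))"
  define h where "h = (\<lambda>m. (1/2) * (y1 m - y2 m))"
  have x: "x \<in> wspace K0 p" and h: "h \<in> wspace K0 p"
    unfolding x_def h_def using y p1
    by (intro D.wspace_scale[of "\<lambda>m. y1 m + y2 m"] D.wspace_scale[of "\<lambda>m. y1 m - y2 m"] D.wspace_add D.wspace_diff; simp)+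
  have hR: "wnorm K0 p h = R"
    unfolding h_def using D.wnorm_scale[OF D.wspace_diff[OF p1 y(1,2)] p1, of "1/2"]
    by (simp add: R_def wdist_def)
  define u where "u = (\<lambda>(ns :: nat list) m. \<tau> * real k powr (- 1 / p) * indicator (set ns) m)"
  have uw: "u ns \<in> wspace K0 p" for ns
    unfolding u_def by (intro D.wspace_scale D.wspace_indicator) simp
  have u_norm: "wnorm K0 p (u ns) \<le> \<tau>" if len: "length ns = k" for ns
  proof -
    have "wnorm K0 p (u ns) = \<tau> * real k powr (- 1 / p) * wnorm K0 p (indicator (set ns))"
      unfolding u_def using l R0 p1
      by (subst D.wnorm_scale) (auto simp: \<tau>_def abs_mult)
    also have "\<dots> \<le> \<tau> * real k powr (- 1 / p) * real k powr (1 / p)"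
    proof (intro mult_left_mono)
      have "wnorm K0 p (indicator (set ns)) \<le> real (card (set ns)) powr (1 / p)"
        by (rule D.wnorm_indicator_le) (use p1 in auto)
      also have "\<dots> \<le> real k powr (1 / p)"
        using card_length[of ns] that p1 by (intro powr_mono2) auto
      finally show "wnorm K0 p (indicator (set ns)) \<le> real k powr (1 / p)" .
    qed (use l R0 in \<open>auto simp: \<tau>_def\<close>)
    also have "\<dots> = \<tau>" using k by (simp flip: powr_add add: mult.assoc)
    finally show ?thesis .
  qed
  define z where "z = (\<lambda>ns m. x m + u ns m)"
  have zw: "z ns \<in> wspace K0 p" for ns unfolding z_def by (intro D.wspace_add p1 x uw)
  have zy: "wdist K0 p (z ns) y1 = wnorm K0 p (\<lambda>m. - h m + u ns m)"
    "wdist K0 p (z ns) y2 = wnorm K0 p (\<lambda>m. h m + u ns m)" for ns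
    unfolding wdist_def z_def x_def h_def by (rule arg_cong[where f = "wnorm K0 p"], simp add: fun_eq_iff field_simps)+
  have lower: "\<theta> \<le> wdist K0 p (z ns) y1" "\<theta> \<le> wdist K0 p (z ns) y2" if "length ns = k" for ns
  proof -
    have "wnorm K0 p h \<le> wnorm K0 p (\<lambda>m. h m + u ns m) + wnorm K0 p (u ns)"
      using D.wnorm_triangle_diff[OF p1 D.wspace_add[OF p1 h uw] uw, of ns ns] by simp
    moreover have "wnorm K0 p (\<lambda>m. - h m) \<le> wnorm K0 p (\<lambda>m. - h m + u ns m) + wnorm K0 p (u ns)"
      using D.wnorm_triangle_diff[OF p1 D.wspace_add[OF p1 D.wspace_uminus[OF h] uw] uw, of ns ns] by simp
    ultimately show "\<theta> \<le> wdist K0 p (z ns) y1" "\<theta> \<le> wdist K0 p (z ns) y2"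
      using u_norm[OF that] hR \<tau>R R(1) by (auto simp: zy D.wnorm_uminus)
  qed
  define G where "G = (1 + l powr p) powr (1 / p)"
  have GR: "(R powr p + \<tau> powr p) powr (1 / p) = G * R"
  proof -
    have "R powr p + \<tau> powr p = (1 + l powr p) * R powr p"
      using l R0 by (simp add: \<tau>_def powr_mult distrib_right)
    then show ?thesis using R0 p1 by (simp add: powr_mult powr_powr G_def)
  qed
  have \<kappa>R: "0 < \<kappa> * R" using \<kappa> R0 by simp
  obtain N1 where N1: "\<And>v. v \<in> wspace K0 p \<Longrightarrow> (\<And>j. j < N1 \<Longrightarrow> v j = 0) \<Longrightarrow> wnorm K0 p v \<le> \<tau> \<Longrightarrow>
      wnorm K0 p (\<lambda>j. h j + v j) \<le> (wnorm K0 p h powr p + \<tau> powr p) powr (1 / p) + \<kappa> * R"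
    by (rule D.wnorm_add_spread[OF p1 h \<kappa>R, of \<tau>]) blast
  obtain N2 where N2: "\<And>v. v \<in> wspace K0 p \<Longrightarrow> (\<And>j. j < N2 \<Longrightarrow> v j = 0) \<Longrightarrow> wnorm K0 p v \<le> \<tau> \<Longrightarrow>
      wnorm K0 p (\<lambda>j. - h j + v j) \<le> (wnorm K0 p (\<lambda>m. - h m) powr p + \<tau> powr p) powr (1 / p) + \<kappa> * R"
    by (rule D.wnorm_add_spread[OF p1 D.wspace_uminus[OF h] \<kappa>R, of \<tau>]) blast
  define a where "a = g y1"
  define b where "b = g y2"
  have ab: "a \<in> Y" "b \<in> Y" using y by (simp_all add: a_def b_def g)
  define w where "w = (\<lambda>i j. (1/2) * (a i j - b i j))"
  define mid where "mid = (\<lambda>i j. (1/2) * (a i j + b i j))"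
  have w: "w \<in> Y" and mid: "mid \<in> Y"
    unfolding w_def mid_def
    using Y_scale[OF Y_diff[OF ab], of "1/2"] Y_scale[OF Y_add[OF ab], of "1/2"] by simp_all
  have rw: "(s - \<kappa>) * R \<le> \<rho> w"
    unfolding w_def using y(4) rho_scale[OF Y_diff[OF ab], of "1/2"] by (simp add: R_def a_def b_def)
  obtain N where N: "\<rho> (rst {N..} w) \<le> \<kappa> * R" using rho_tail_small[OF w \<kappa>R] by blast
  have tail: "\<rho> (rst {N..} (\<lambda>i j. g (z ns) i j - mid i j)) \<le> \<epsilon> / 2 * \<tau>"
    if len: "length ns = k" and far: "\<forall>n\<in>set ns. max N1 N2 < n" for ns
  proof -
    define v where "v = (\<lambda>i j. g (z ns) i j - mid i j)"
    have v: "v \<in> Y" unfolding v_def by (intro Y_diff g zw mid)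
    have u0: "u ns j = 0" if "j < max N1 N2" for j
      using far that by (auto simp: u_def indicator_def)
    define P where "P = (s + \<kappa>) * ((G + \<kappa>) * R)"
    have d1: "wdist K0 p (z ns) y1 \<le> (G + \<kappa>) * R"
      using N2[OF uw _ u_norm[OF len]] u0 hR GR by (simp add: zy D.wnorm_uminus distrib_right)
    have d2: "wdist K0 p (z ns) y2 \<le> (G + \<kappa>) * R"
      using N1[OF uw _ u_norm[OF len]] u0 hR GR by (simp add: zy distrib_right)
    have "(s + \<kappa>) * wdist K0 p (z ns) y1 \<le> P" "(s + \<kappa>) * wdist K0 p (z ns) y2 \<le> P"
      unfolding P_def using s(1) \<kappa> by (intro mult_left_mono d1 d2, simp)+
    moreover have "(\<lambda>i j. v i j - w i j) = (\<lambda>i j. g (z ns) i j - g y1 i j)"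
      "(\<lambda>i j. v i j + w i j) = (\<lambda>i j. g (z ns) i j - g y2 i j)"
      by (auto simp: v_def w_def mid_def a_def b_def fun_eq_iff field_simps)
    ultimately have P: "\<rho> (\<lambda>i j. v i j - w i j) \<le> P" "\<rho> (\<lambda>i j. v i j + w i j) \<le> P"
      using \<theta>(2)[OF zw y(1) lower(1)[OF len]] \<theta>(2)[OF zw y(2) lower(2)[OF len]] by auto
    have "\<rho> (rst {N..} v) powr q \<le> (P + \<kappa> * R) powr q - (max 0 (\<rho> w - \<kappa> * R)) powr q"
      by (rule rho_midpoint_tail[OF v w P N])
    also have "\<dots> \<le> (P + \<kappa> * R) powr q - (max 0 (s - 2 * \<kappa>) * R) powr q"
    proof -
      have "(s - 2 * \<kappa>) * R \<le> \<rho> w - \<kappa> * R" using rw by (simp add: algebra_simps)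
      moreover have "max 0 (s - 2 * \<kappa>) * R = max 0 ((s - 2 * \<kappa>) * R)"
        using R0 by (simp only: max_mult_distrib_right) simp
      ultimately have "max 0 (s - 2 * \<kappa>) * R \<le> max 0 (\<rho> w - \<kappa> * R)" by simp
      then have "(max 0 (s - 2 * \<kappa>) * R) powr q \<le> (max 0 (\<rho> w - \<kappa> * R)) powr q"
        using R0 q_ge by (intro powr_mono2) auto
      then show ?thesis by simp
    qed
    \<comment> \<open>All quantities scale with \<open>R\<close>, so \<open>par\<close>, which is
      stated for half-distance 1, applies.\<close>
    also have "\<dots> = R powr q * (((s + \<kappa>) * (G + \<kappa>) + \<kappa>) powr q - (max 0 (s - 2 * \<kappa>)) powr q)"
    proof -
      have "P + \<kappa> * R = R * ((s + \<kappa>) * (G + \<kappa>) + \<kappa>)" by (simp add: P_def algebra_simps)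
      then show ?thesis by (simp add: powr_mult right_diff_distrib)
    qed
    also have "\<dots> \<le> R powr q * (\<epsilon> / 2 * l) powr q"
      using par by (intro mult_left_mono) (auto simp: G_def)
    also have "\<dots> = (\<epsilon> / 2 * \<tau>) powr q" by (simp add: \<tau>_def mult_ac flip: powr_mult)
    finally have "\<rho> (rst {N..} v) powr q \<le> (\<epsilon> / 2 * \<tau>) powr q" .
    then have "\<rho> (rst {N..} v) \<le> \<epsilon> / 2 * \<tau>"
      by (rule powr_le_powr_imp_le) (use q_ge \<epsilon> \<tau> \<tau>0 in simp_all)
    then show ?thesis by (simp add: v_def)
  qed
  define B where "B = H (g x) + (\<bar>L\<bar> * \<tau> + \<bar>L\<bar>)"
  have bound: "wnorm K (ps i) (g (z ns) i) \<le> B" if len: "length ns = k" and i: "i \<in> I" for ns i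
  proof -
    have "wdist K0 p (z ns) x = wnorm K0 p (u ns)" by (simp add: wdist_def z_def)
    then have dx: "0 \<le> wdist K0 p (z ns) x" "wdist K0 p (z ns) x \<le> \<tau>" using u_norm[OF len] by simp_all
    have "wnorm K (ps i) (g (z ns) i) \<le> H (g (z ns))"
      unfolding hnorm_def using i finite_I
      by (intro member_le_sum[where f = "\<lambda>i. wnorm K (ps i) (g (z ns) i)"]) auto
    also have "\<dots> \<le> H (\<lambda>i j. g (z ns) i j - g x i j) + H (g x)"
      using H_triangle[OF Y_diff[OF g[OF zw] g[OF x]] g[OF x], of ns] by simp
    also have "H (\<lambda>i j. g (z ns) i j - g x i j) \<le> L * wdist K0 p (z ns) x + L"
      by (rule Lip[OF zw x])
    also have "L * wdist K0 p (z ns) x \<le> \<bar>L\<bar> * \<tau>" using dx by (intro mult_mono) auto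
    finally show ?thesis by (simp add: B_def)
  qed
  have \<epsilon>\<tau>: "0 < \<epsilon> / 2 * \<tau>" using \<epsilon> \<tau> \<tau>0 by simp
  obtain c0 where c0: "\<forall>\<^sub>F ns in tuples k. H (rst {..<N} (\<lambda>i j. g (z ns) i j - c0 i j)) \<le> \<epsilon> / 2 * \<tau>"
    by (rule tuples_head_converge[of k "\<lambda>ns. g (z ns)" B "\<epsilon> / 2 * \<tau>" N, OF g[OF zw] bound \<epsilon>\<tau>]) blast+
  \<comment> \<open>Below \<open>N\<close> the centre is the coordinatewise limit, from
    \<open>N\<close> on the midpoint of the two images. Cutting \<open>c0\<close> gives finite
    support and thus membership in \<open>Y\<close>.\<close>
  define c where "c = (\<lambda>i j. rst {..<N} c0 i j + rst {N..} mid i j)"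
  have c1: "rst {..<N} c0 \<in> Y"
    unfolding hspace_def rst_def by (auto simp: restr_def intro!: wspace_finite_support[of "{..<N}"] split: if_splits)
  have c: "c \<in> Y" unfolding c_def by (rule Y_add[OF c1 Y_rst[OF mid]])
  have "\<forall>\<^sub>F ns in tuples k. H (\<lambda>i j. g (z ns) i j - c i j) \<le> \<epsilon> * \<tau>"
    using c0 eventually_tuples_length[of k] eventually_tuples_gt[of "max N1 N2" k]
  proof eventually_elim
    case (elim ns)
    let ?h = "rst {..<N} (\<lambda>i j. g (z ns) i j - c i j)"
    let ?t = "rst {N..} (\<lambda>i j. g (z ns) i j - mid i j)"
    have h_eq: "?h = rst {..<N} (\<lambda>i j. g (z ns) i j - c0 i j)"
      by (auto simp: c_def rst_def restr_def fun_eq_iff)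
    have "(\<lambda>i j. g (z ns) i j - c i j) = (\<lambda>i j. ?h i j + ?t i j)"
      by (auto simp: c_def rst_def restr_def fun_eq_iff)
    then have "H (\<lambda>i j. g (z ns) i j - c i j) \<le> H ?h + H ?t"
      using H_triangle[of ?h ?t] by (simp add: Y_rst Y_diff g zw mid c)
    also have "H ?t \<le> \<rho> ?t" by (intro H_le_rho Y_rst Y_diff g zw mid)
    also have "\<dots> \<le> \<epsilon> / 2 * \<tau>" using elim by (intro tail) auto
    finally show ?case using elim(1) by (simp add: h_eq)
  qed
  then show ?thesis using that[OF \<tau> x c] by (simp add: z_def u_def)
qed

end

section \<open>Nonexistence of coarse Lipschitz embeddings\<close>

context tsirelson_weights begin

lemma wdist_le_center:
  assumes "1 \<le> p" "x \<in> wspace K p" "y \<in> wspace K p" "c \<in> wspace K p"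
  shows "wdist K p x y \<le> wnorm K p (\<lambda>i. x i - c i) + wnorm K p (\<lambda>i. y i - c i)"
  using wnorm_triangle_diff[OF assms(1) wspace_diff[OF assms(1,2,4)] wspace_diff[OF assms(1,3,4)]]
  by (simp add: wdist_def)

text \<open>The difference has modulus 1 on \<open>2 * k\<close> coordinates, so
  \<open>card_le_wmod_indicator\<close> bounds its \<open>wmod\<close> below by
  \<open>k / 2\<close>.\<close>

lemma wnorm_indicator_diff_ge:
  assumes p: "1 \<le> p" and ns: "distinct ns" "length ns = k" and ms: "distinct ms" "length ms = k"
    and disj: "set ns \<inter> set ms = {}"
  shows "real k powr (1 / p) / 2 \<le> wnorm K p (\<lambda>i. indicator (set ns) i - indicator (set ms) i)"
proof -
  let ?A = "set ns \<union> set ms"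
  have "card ?A = 2 * k"
    using disj ns ms by (simp add: card_Un_disjoint distinct_card)
  then have "real k / 2 \<le> wmod K p (indicator ?A)"
    using card_le_wmod_indicator[OF p, of ?A] by simp
  then have "(real k / 2) powr (1 / p) \<le> wnorm K p (indicator ?A)"
    unfolding wnorm_def using p by (intro powr_mono2) auto
  also have "\<dots> \<le> wnorm K p (\<lambda>i. indicator (set ns) i - indicator (set ms) i)"
    by (intro wnorm_mono wspace_diff wspace_indicator p) (use disj in \<open>auto simp: indicator_def\<close>)
  finally have "(real k / 2) powr (1 / p) \<le> wnorm K p (\<lambda>i. indicator (set ns) i - indicator (set ms) i)" .
  moreover have "2 powr (1 / p) \<le> (2 :: real)"
    using powr_mono[of "1 / p" 1 "2 :: real"] p by simp
  then have "real k powr (1 / p) / 2 \<le> real k powr (1 / p) / 2 powr (1 / p)"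
    by (intro divide_left_mono) auto
  then have "real k powr (1 / p) / 2 \<le> (real k / 2) powr (1 / p)"
    by (simp add: powr_divide)
  ultimately show ?thesis by simp
qed

lemma wnorm_indicator_exchange_le:
  assumes p: "1 \<le> p"
  shows "wnorm K p (\<lambda>i. indicator (set (as @ n # bs)) i - indicator (set (as @ m # bs)) i) \<le> 2"
proof -
  have "wnorm K p (\<lambda>i. indicator (set (as @ n # bs)) i - indicator (set (as @ m # bs)) i)
      \<le> wnorm K p (indicator {n, m})"
    using p by (intro wnorm_mono) (auto simp: indicator_def)
  also have "\<dots> \<le> real (card {n, m}) powr (1 / p)" by (rule wnorm_indicator_le) (use p in auto)
  also have "\<dots> \<le> 2 powr (1 / p)" using p by (intro powr_mono2) (auto simp: card_insert_if)
  also have "\<dots> \<le> 2" using powr_mono[of "1 / p" 1 "2 :: real"] p by simp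
  finally show ?thesis .
qed

end

text \<open>The order of choices matters: first \<open>k\<close>, to shrink the components with
  larger exponent; then \<open>\<tau>0\<close>, to beat additive constants that depend on
  \<open>k\<close>; only then \<open>\<tau> \<ge> \<tau>0\<close> and \<open>x\<close>, supplied by
  the collapse of the other components.\<close>

lemma no_coarse_lipschitz_map:
  fixes n :: nat and f :: "(nat \<Rightarrow> real) \<Rightarrow> nat \<Rightarrow> nat \<Rightarrow> real"
  assumes D: "tsirelson_weights K0" and T: "tsirelson_weights K" and p: "1 \<le> p"
    and ps: "\<And>i. i < n \<Longrightarrow> 1 \<le> ps i" "\<And>i. i < n \<Longrightarrow> ps i \<noteq> p"
    and f: "\<And>x i. x \<in> wspace K0 p \<Longrightarrow> i < n \<Longrightarrow> f x i \<in> wspace K (ps i)"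
    and L: "0 < L"
    and upper: "\<And>x y. x \<in> wspace K0 p \<Longrightarrow> y \<in> wspace K0 p \<Longrightarrow>
      (\<Sum>i<n. wdist K (ps i) (f x i) (f y i)) \<le> L * wdist K0 p x y + L"
    and lower: "\<And>x y. x \<in> wspace K0 p \<Longrightarrow> y \<in> wspace K0 p \<Longrightarrow>
      wdist K0 p x y / L - L \<le> (\<Sum>i<n. wdist K (ps i) (f x i) (f y i))"
  shows False
proof -
  interpret D: tsirelson_weights K0 by fact
  interpret T: tsirelson_weights K by fact
  define I where "I = {i. i < n \<and> ps i < p}"
  define J where "J = {i. i < n \<and> p < ps i}"
  have fin: "finite I" "finite J" by (simp_all add: I_def J_def)
  have IJ: "{..<n} = I \<union> J" "I \<inter> J = {}" using ps(2) by (auto simp: I_def J_def neq_iff)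
  have comp_le: "wdist K (ps i) (f x i) (f y i) \<le> L * wdist K0 p x y + L"
    if "x \<in> wspace K0 p" "y \<in> wspace K0 p" "i < n" for x y i
  proof -
    have "wdist K (ps i) (f x i) (f y i) \<le> (\<Sum>i<n. wdist K (ps i) (f x i) (f y i))"
      using that by (intro member_le_sum[where f = "\<lambda>i. wdist K (ps i) (f x i) (f y i)"]) (auto simp: wdist_def)
    then show ?thesis using upper[OF that(1,2)] by simp
  qed
  define X where "X = (\<lambda>k x \<tau> (ns :: nat list) m. x m + \<tau> * real k powr (- 1 / p) * indicator (set ns) m)"
  have low: "\<exists>\<tau>\<ge>\<tau>0. \<exists>x\<in>wspace K0 p. \<exists>c\<in>hspace K I ps.
      \<forall>\<^sub>F ns in tuples k. hnorm K I ps (\<lambda>i j. f (X k x \<tau> ns) i j - c i j) \<le> \<epsilon> * \<tau>"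
    if pos: "0 < \<epsilon>" "0 < k" "0 < \<tau>0" for \<epsilon> k \<tau>0
  \<comment> \<open>Without smaller exponents the bound concerns an empty sum; otherwise their
    maximum exists and determines \<open>q\<close>.\<close>
  proof (cases "I = {}")
    case True
    then show ?thesis
      using pos by (intro exI[of _ \<tau>0] conjI bexI[of _ "\<lambda>_. 0"] bexI[of _ "\<lambda>_ _. 0"])
        (auto simp: hnorm_def hspace_def)
  next
    case False
    define q where "q = (Max (ps ` I) + p) / 2"
    have "Max (ps ` I) \<in> ps ` I" using False fin by (intro Max_in) auto
    then have M: "1 \<le> Max (ps ` I)" "Max (ps ` I) < p" using ps by (auto simp: I_def)
    interpret lower_sum K I ps q
    proof
      show "ps i < q" if "i \<in> I" for i
      proof -
        have "ps i \<le> Max (ps ` I)" using that fin by simp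
        then show ?thesis using M(2) unfolding q_def by simp
      qed
    qed (use M fin ps(1) in \<open>auto simp: q_def I_def\<close>)
    have "\<And>x. x \<in> wspace K0 p \<Longrightarrow> f x \<in> hspace K I ps"
      using f by (auto simp: hspace_def I_def)
    moreover have "hnorm K I ps (\<lambda>i j. f x i j - f y i j) \<le> L * wdist K0 p x y + L"
      if "x \<in> wspace K0 p" "y \<in> wspace K0 p" for x y
    proof -
      have "hnorm K I ps (\<lambda>i j. f x i j - f y i j) \<le> (\<Sum>i<n. wdist K (ps i) (f x i) (f y i))"
        unfolding hnorm_def wdist_def by (intro sum_mono2) (auto simp: I_def)
      then show ?thesis using upper[OF that] by simp
    qed
    moreover have "q < p" using M by (simp add: q_def)
    ultimately obtain \<tau> x c where "\<tau>0 \<le> \<tau>" "x \<in> wspace K0 p" "c \<in> hspace K I ps"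
      "\<forall>\<^sub>F ns in tuples k. hnorm K I ps (\<lambda>i j. f (X k x \<tau> ns) i j - c i j) \<le> \<epsilon> * \<tau>"
      using tuples_collapse[OF D, of p f L \<epsilon> k \<tau>0] pos unfolding X_def by blast
    then show ?thesis by blast
  qed
  \<comment> \<open>For \<open>i \<in> J\<close> the exponent \<open>1 / ps i - 1 / p\<close> is
    negative, so long tuples make the contribution proportional to \<open>\<tau>\<close> as small as
    desired.\<close>
  have "((\<lambda>k. \<Sum>i\<in>J. 4 * L * real k powr (1 / ps i - 1 / p)) \<longlongrightarrow> (\<Sum>i\<in>J. 4 * L * 0)) sequentially"
  proof (intro tendsto_sum tendsto_mult tendsto_const)
    fix i assume i: "i \<in> J"
    have "1 / ps i - 1 / p < 0" using i p by (auto simp: J_def frac_less2)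
    then show "((\<lambda>k. real k powr (1 / ps i - 1 / p)) \<longlongrightarrow> 0) sequentially"
      by (intro tendsto_neg_powr filterlim_real_sequentially)
  qed
  then have "\<forall>\<^sub>F k in sequentially. (\<Sum>i\<in>J. 4 * L * real k powr (1 / ps i - 1 / p)) < 1 / (8 * L)"
    using L by (intro order_tendstoD) auto
  then have "\<exists>k. (\<Sum>i\<in>J. 4 * L * real k powr (1 / ps i - 1 / p)) < 1 / (8 * L) \<and> 0 < k"
    by (intro eventually_happens'[OF sequentially_bot] eventually_conj eventually_gt_at_top)
  then obtain k where k: "(\<Sum>i\<in>J. 4 * L * real k powr (1 / ps i - 1 / p)) < 1 / (8 * L)" "0 < k" by blast
  \<comment> \<open>The part of the final bound for \<open>J\<close> that does not grow with
    \<open>\<tau>\<close>.\<close>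
  define M where "M = (\<Sum>i\<in>J. 2 * (L * real k powr (1 / ps i) + 1))"
  have M0: "0 \<le> M" using L by (simp add: M_def sum_nonneg)
  \<comment> \<open>The closing comparison yields \<open>\<tau> / (4 * L) \<le> L + M\<close>; the
    summand 1 makes it fail.\<close>
  define \<tau>0 where "\<tau>0 = 4 * L * (L + M) + 1"
  have "0 < \<tau>0" using L M0 by (simp add: \<tau>0_def add_nonneg_pos)
  then obtain \<tau> x c where \<tau>: "\<tau>0 \<le> \<tau>" and x: "x \<in> wspace K0 p" and c: "c \<in> hspace K I ps"
    and small: "\<forall>\<^sub>F ns in tuples k. hnorm K I ps (\<lambda>i j. f (X k x \<tau> ns) i j - c i j) \<le> 1 / (16 * L) * \<tau>"
    using low[of "1 / (16 * L)" k \<tau>0] L k(2) by auto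
  have \<tau>pos: "0 < \<tau>" using \<tau> \<open>0 < \<tau>0\<close> by simp
  define z where "z = X k x \<tau>"
  define t where "t = \<tau> * real k powr (- 1 / p)"
  have t: "0 < t" using \<tau>pos k by (simp add: t_def)
  have z_eq: "z ns = (\<lambda>m. x m + t * indicator (set ns) m)" for ns
    by (simp add: z_def X_def t_def)
  have ind: "(\<lambda>m. t * indicator (set ns) m) \<in> wspace K0 p" for ns :: "nat list"
    by (intro D.wspace_scale D.wspace_indicator) simp
  have zw: "z ns \<in> wspace K0 p" for ns
    unfolding z_eq by (intro D.wspace_add p x ind)
  have z_diff: "wdist K0 p (z ns) (z ms) = t * wnorm K0 p (\<lambda>m. indicator (set ns) m - indicator (set ms) m)" for ns ms
  proof -
    have "(\<lambda>m. z ns m - z ms m) = (\<lambda>m. t * (indicator (set ns) m - indicator (set ms) m))"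
      by (simp add: z_eq right_diff_distrib)
    moreover have "(\<lambda>m. indicator (set ns) m - indicator (set ms) m) \<in> wspace K0 p"
      by (intro D.wspace_diff p D.wspace_indicator) auto
    ultimately show ?thesis
      using t p D.wnorm_scale[of "\<lambda>m. indicator (set ns) m - indicator (set ms) m" p t] by (simp add: wdist_def)
  qed
  \<comment> \<open>Exchanging one entry moves \<open>z ns\<close> by at most \<open>t * 2\<close>;
    \<open>upper\<close> turns this into \<open>\<Lambda>\<close>.\<close>
  define \<Lambda> where "\<Lambda> = L * (t * 2) + L"
  have \<Lambda>: "0 \<le> \<Lambda>" using L t by (simp add: \<Lambda>_def)
  have high: "\<exists>u\<in>wspace K (ps i). \<forall>\<^sub>F ns in tuples k.
      wnorm K (ps i) (\<lambda>j. f (z ns) i j - u j) \<le> real k powr (1 / ps i) * \<Lambda> + 1" if "i \<in> J" for i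
  proof -
    have i: "i < n" "1 \<le> ps i" using that ps by (auto simp: J_def)
    have "f (z ns) i \<in> wspace K (ps i) \<and>
        wnorm K (ps i) (f (z ns) i) \<le> wnorm K (ps i) (f x i) + (L * (t * real k powr (1 / p)) + L)"
      if len: "length ns = k" for ns
    proof
      show fz: "f (z ns) i \<in> wspace K (ps i)" using f zw i by blast
      have "wdist K0 p (z ns) x = t * wnorm K0 p (indicator (set ns))"
        using t p D.wnorm_scale[of "indicator (set ns)" p t] by (simp add: wdist_def z_eq)
      also have "\<dots> \<le> t * real k powr (1 / p)"
      proof (intro mult_left_mono)
        have "wnorm K0 p (indicator (set ns)) \<le> real (card (set ns)) powr (1 / p)"
          by (rule D.wnorm_indicator_le) (use p in auto)
        also have "\<dots> \<le> real k powr (1 / p)"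
          using card_length[of ns] len p by (intro powr_mono2) auto
        finally show "wnorm K0 p (indicator (set ns)) \<le> real k powr (1 / p)" .
      qed (use t in simp)
      finally have "L * wdist K0 p (z ns) x \<le> L * (t * real k powr (1 / p))"
        using L by (intro mult_left_mono) auto
      then have "wdist K (ps i) (f (z ns) i) (f x i) \<le> L * (t * real k powr (1 / p)) + L"
        using comp_le[OF zw x i(1), of ns] by simp
      moreover have "wnorm K (ps i) (f (z ns) i) \<le> wdist K (ps i) (f (z ns) i) (f x i) + wnorm K (ps i) (f x i)"
        using T.wnorm_triangle[OF i(2) T.wspace_diff[OF i(2) fz f[OF x i(1)]] f[OF x i(1)]] by (simp add: wdist_def)
      ultimately show "wnorm K (ps i) (f (z ns) i) \<le> wnorm K (ps i) (f x i) + (L * (t * real k powr (1 / p)) + L)"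
        by simp
    qed
    moreover have "wnorm K (ps i) (\<lambda>j. f (z (as @ a # bs)) i j - f (z (as @ b # bs)) i j) \<le> \<Lambda>" for as a bs b
    proof -
      have "wdist K0 p (z (as @ a # bs)) (z (as @ b # bs)) \<le> t * 2"
        unfolding z_diff using t D.wnorm_indicator_exchange_le[OF p] by (intro mult_left_mono) auto
      then have "L * wdist K0 p (z (as @ a # bs)) (z (as @ b # bs)) \<le> L * (t * 2)"
        using L by (intro mult_left_mono) auto
      then show ?thesis
        using comp_le[OF zw zw i(1), of "as @ a # bs" "as @ b # bs"] by (simp add: wdist_def \<Lambda>_def)
    qed
    ultimately show ?thesis
      using T.tuples_concentration[OF i(2) \<Lambda>, of k "\<lambda>ns. f (z ns) i"] zero_less_one by blast
  qed
  then have "\<exists>u. \<forall>i\<in>J. u i \<in> wspace K (ps i) \<and> (\<forall>\<^sub>F ns in tuples k.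
      wnorm K (ps i) (\<lambda>j. f (z ns) i j - u i j) \<le> real k powr (1 / ps i) * \<Lambda> + 1)"
    by (intro bchoice) blast
  then obtain u where u: "\<And>i. i \<in> J \<Longrightarrow> u i \<in> wspace K (ps i)"
    "\<And>i. i \<in> J \<Longrightarrow> \<forall>\<^sub>F ns in tuples k. wnorm K (ps i) (\<lambda>j. f (z ns) i j - u i j) \<le> real k powr (1 / ps i) * \<Lambda> + 1"
    by blast
  define good where "good = (\<lambda>ns. hnorm K I ps (\<lambda>i j. f (z ns) i j - c i j) \<le> 1 / (16 * L) * \<tau> \<and>
    (\<forall>i\<in>J. wnorm K (ps i) (\<lambda>j. f (z ns) i j - u i j) \<le> real k powr (1 / ps i) * \<Lambda> + 1) \<and>
    distinct ns \<and> length ns = k)"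
  have "\<forall>\<^sub>F ns in tuples k. \<forall>i\<in>J. wnorm K (ps i) (\<lambda>j. f (z ns) i j - u i j) \<le> real k powr (1 / ps i) * \<Lambda> + 1"
    by (rule eventually_ball_finite[OF fin(2)]) (use u(2) in blast)
  then have good: "eventually good (tuples k)"
    unfolding good_def
    by (intro eventually_conj small[folded z_def] eventually_tuples_distinct eventually_tuples_length)
  obtain ns where ns: "good ns" using eventually_happens'[OF tuples_neq_bot good] by blast
  \<comment> \<open>Taking \<open>ms\<close> beyond all entries of \<open>ns\<close> makes the
    supports disjoint, so the two points are at least \<open>\<tau> / 2\<close> apart.\<close>
  have "\<exists>ms. good ms \<and> (\<forall>m\<in>set ms. Max (insert 0 (set ns)) < m)"
    by (rule eventually_happens'[OF tuples_neq_bot eventually_conj[OF good eventually_tuples_gt]])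
  then obtain ms where ms: "good ms" "\<forall>m\<in>set ms. Max (insert 0 (set ns)) < m" by blast
  have disj: "set ns \<inter> set ms = {}"
  proof -
    have "n \<le> Max (insert 0 (set ns))" if "n \<in> set ns" for n using that by (intro Max_ge) auto
    then show ?thesis using ms(2) by fastforce
  qed
  have "\<tau> / 2 \<le> wdist K0 p (z ns) (z ms)"
  proof -
    have "\<tau> / 2 = t * (real k powr (1 / p) / 2)"
      using k by (simp add: t_def mult.assoc flip: powr_add)
    also have "\<dots> \<le> wdist K0 p (z ns) (z ms)"
      unfolding z_diff using t ns ms disj
      by (intro mult_left_mono D.wnorm_indicator_diff_ge[OF p]) (auto simp: good_def)
    finally show ?thesis .
  qed
  then have "\<tau> / 2 / L \<le> wdist K0 p (z ns) (z ms) / L" using L by (intro divide_right_mono) auto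
  then have ge: "\<tau> / (2 * L) - L \<le> (\<Sum>i<n. wdist K (ps i) (f (z ns) i) (f (z ms) i))"
    using lower[OF zw zw, of ns ms] by simp
  have "(\<Sum>i\<in>I. wdist K (ps i) (f (z ns) i) (f (z ms) i)) \<le>
      (\<Sum>i\<in>I. wnorm K (ps i) (\<lambda>j. f (z ns) i j - c i j) + wnorm K (ps i) (\<lambda>j. f (z ms) i j - c i j))"
    by (intro sum_mono T.wdist_le_center f zw) (use ps(1) c in \<open>auto simp: I_def hspace_def\<close>)
  also have "\<dots> \<le> 1 / (16 * L) * \<tau> + 1 / (16 * L) * \<tau>"
    unfolding sum.distrib using ns ms(1) by (intro add_mono) (auto simp: good_def hnorm_def)
  finally have sI: "(\<Sum>i\<in>I. wdist K (ps i) (f (z ns) i) (f (z ms) i)) \<le> \<tau> / (8 * L)" by simp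
  have "(\<Sum>i\<in>J. wdist K (ps i) (f (z ns) i) (f (z ms) i)) \<le> (\<Sum>i\<in>J. 2 * (real k powr (1 / ps i) * \<Lambda> + 1))"
  proof (intro sum_mono)
    fix i assume i: "i \<in> J"
    have "wdist K (ps i) (f (z ns) i) (f (z ms) i) \<le>
        wnorm K (ps i) (\<lambda>j. f (z ns) i j - u i j) + wnorm K (ps i) (\<lambda>j. f (z ms) i j - u i j)"
      by (intro T.wdist_le_center f zw u) (use ps(1) i in \<open>auto simp: J_def\<close>)
    then show "wdist K (ps i) (f (z ns) i) (f (z ms) i) \<le> 2 * (real k powr (1 / ps i) * \<Lambda> + 1)"
      using ns ms(1) i by (fastforce simp: good_def)
  qed
  also have "\<dots> = \<tau> * (\<Sum>i\<in>J. 4 * L * real k powr (1 / ps i - 1 / p)) + M"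
  proof -
    have "2 * (real k powr (1 / ps i) * \<Lambda> + 1) =
        \<tau> * (4 * L * real k powr (1 / ps i - 1 / p)) + 2 * (L * real k powr (1 / ps i) + 1)" for i
      by (simp add: \<Lambda>_def t_def powr_diff powr_minus_divide algebra_simps)
    then show ?thesis by (simp add: M_def sum.distrib sum_distrib_left)
  qed
  also have "\<dots> \<le> \<tau> * (1 / (8 * L)) + M"
    using k(1) \<tau>pos by (intro add_mono mult_left_mono) auto
  finally have sJ: "(\<Sum>i\<in>J. wdist K (ps i) (f (z ns) i) (f (z ms) i)) \<le> \<tau> / (8 * L) + M" by simp
  have "\<tau> / (2 * L) - L \<le> \<tau> / (8 * L) + (\<tau> / (8 * L) + M)"
    using ge sI sJ unfolding IJ(1) sum.union_disjoint[OF fin IJ(2)] by linarith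
  moreover have "\<tau> / (2 * L) = 2 * (\<tau> / (4 * L))" "\<tau> / (8 * L) = \<tau> / (4 * L) / 2" by simp_all
  ultimately have "\<tau> / (4 * L) \<le> L + M" by linarith
  then have "\<tau> \<le> 4 * L * (L + M)" using L by (simp add: pos_divide_le_eq mult.commute)
  then show False using \<tau> by (simp add: \<tau>0_def)
qed

section \<open>The Tsirelson norm\<close>

text \<open>The definition compares neighbouring sets; nonemptiness carries the comparison across
  the sets in between.\<close>

lemma admissible_less:
  assumes "admissible k E" "i < j" "j < k" "a \<in> E i" "b \<in> E j"
  shows "a < b"
  using assms(2,3,5)
proof (induction j arbitrary: b)
  case (Suc j)
  have E: "finite (E j)" "E j \<noteq> {}" "finite (E (Suc j))" "Max (E j) < Min (E (Suc j))"
    using assms(1) Suc.prems unfolding admissible_def by auto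
  have "Max (E j) < b" using E Suc.prems by (meson Min_le less_le_trans)
  moreover have "a \<le> Max (E j)"
  proof (cases "i = j")
    case True
    then show ?thesis using E assms(4) by simp
  next
    case False
    then have "a < Max (E j)" using Suc.IH[of "Max (E j)"] Suc.prems E by simp
    then show ?thesis by simp
  qed
  ultimately show ?case by simp
qed simp

lemma admissible_disjoint:
  assumes "admissible k E" "i < k" "j < k" "a \<in> E i" "a \<in> E j"
  shows "i = j"
  using admissible_less[OF assms(1), of i j a a] admissible_less[OF assms(1), of j i a a] assms
  by (metis less_irrefl linorder_neqE_nat)

lemma admissible_sum_single:
  assumes "admissible k E" "j < k" "a \<in> E j"
  shows "(\<Sum>i<k. if a \<in> E i then F i else 0) = (F j :: real)"
proof -
  have "(\<Sum>i<k. if a \<in> E i then F i else 0) = (\<Sum>i<k. if i = j then F i else 0)"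
  proof (intro sum.cong refl)
    fix i assume "i \<in> {..<k}"
    then show "(if a \<in> E i then F i else 0) = (if i = j then F i else 0)"
      using admissible_disjoint[OF assms(1) _ assms(2) _ assms(3), of i] assms(3) by (cases "i = j") auto
  qed
  then show ?thesis using assms by simp
qed

text \<open>The norming set of Tsirelson's space (restricted to nonnegative functionals).\<close>

inductive_set TK :: "(nat \<Rightarrow> real) set" where
  TK_unit: "indicator {i} \<in> TK"
| TK_admissible: "admissible k E \<Longrightarrow> (\<And>j. j < k \<Longrightarrow> \<phi>s j \<in> TK) \<Longrightarrow>
    (\<lambda>i. (1/2) * (\<Sum>j<k. if i \<in> E j then \<phi>s j i else 0)) \<in> TK"

text \<open>By disjointness at most one summand of a half sum is nonzero at a given point, whence
  the bound 1.\<close>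

interpretation TK: tsirelson_weights TK
proof
  show nonneg: "0 \<le> \<phi> i" if "\<phi> \<in> TK" for \<phi> i
    using that by induction (auto intro!: sum_nonneg)
  show "\<phi> i \<le> 1" if "\<phi> \<in> TK" for \<phi> i
    using that
  proof induction
    case (TK_admissible k E \<phi>s)
    show ?case
    proof (cases "\<exists>j<k. i \<in> E j")
      case True
      then obtain j where "j < k" "i \<in> E j" by blast
      then show ?thesis
        using admissible_sum_single[OF TK_admissible(1), of j i "\<lambda>j. \<phi>s j i"] TK_admissible(3)[of j] by simp
    next
      case False
      then have "(\<Sum>j<k. if i \<in> E j then \<phi>s j i else 0) = 0" by (intro sum.neutral) auto
      then show ?thesis by simp
    qed
  qed (simp add: indicator_def)
  show "\<exists>\<phi>\<in>TK. \<phi> i = 1" for i by (rule bexI[OF _ TK_unit[of i]]) simp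
  show "\<exists>\<psi>\<in>TK. \<forall>i. (1/2) * (\<Sum>j<k. if i \<in> E j then \<phi>s j i else 0) \<le> \<psi> i"
    if "admissible k E" "\<And>j. j < k \<Longrightarrow> \<phi>s j \<in> TK" for k E \<phi>s
    by (rule bexI[OF _ TK_admissible[OF that]]) simp_all
qed

section \<open>The modulus of \<open>TK\<close> solves the implicit equation\<close>

lemma c00_restr: "x \<in> c00 \<Longrightarrow> restr E x \<in> c00"
  by (auto simp: c00_def restr_def elim: rev_finite_subset)

lemma c00_wspace: "x \<in> c00 \<Longrightarrow> x \<in> wspace TK p"
  by (rule TK.wspace_finite_support[of "{i. x i \<noteq> 0}"]) (auto simp: c00_def)

lemma wnorm_one_eq_wmod: "x \<in> wspace TK 1 \<Longrightarrow> wnorm TK 1 x = wmod TK 1 x"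
  using TK.wmod_nonneg by (simp add: wnorm_def)

lemma c00_bdd_above_abs:
  assumes "x \<in> c00"
  shows "bdd_above (range (\<lambda>i. \<bar>x i\<bar>))"
  using TK.abs_coord_le_wnorm[OF _ c00_wspace[OF assms], of 1] by (auto intro!: bdd_aboveI)

lemma is_norm_on_c00_wmod: "is_norm_on_c00 (\<lambda>x. if x \<in> c00 then wmod TK 1 x else 0)"
proof -
  have w: "wmod TK 1 x = wnorm TK 1 x" if "x \<in> c00" for x
    using wnorm_one_eq_wmod c00_wspace that by simp
  have sc: "(\<lambda>i. c * x i) \<in> c00" if "x \<in> c00" for x c
    using that by (auto simp: c00_def elim: rev_finite_subset)
  have ad: "(\<lambda>i. x i + y i) \<in> c00" if "x \<in> c00" "y \<in> c00" for x y
    using that by (auto simp: c00_def intro: finite_subset[of _ "{i. x i \<noteq> 0} \<union> {i. y i \<noteq> 0}"])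
  have zero: "wnorm TK 1 x = 0 \<longleftrightarrow> x = (\<lambda>_. 0)" if "x \<in> c00" for x
  proof
    assume "wnorm TK 1 x = 0"
    then show "x = (\<lambda>_. 0)"
      using TK.abs_coord_le_wnorm[OF _ c00_wspace[OF that], of 1] by (simp add: fun_eq_iff)
  qed simp
  show ?thesis
    unfolding is_norm_on_c00_def
    by (simp add: w sc ad zero TK.wnorm_scale TK.wnorm_triangle c00_wspace)
qed

lemma ex_admissible: "admissible 1 (\<lambda>_. {0})"
  by (simp add: admissible_def)

text \<open>The rules generating \<open>TK\<close> mirror the equation: unit functionals produce the
  sup norm, half sums the other term. The upper bound is a case distinction on the last
  rule.\<close>

lemma tsirelson_eq_wmod: "tsirelson_eq (\<lambda>x. if x \<in> c00 then wmod TK 1 x else 0)"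
  unfolding tsirelson_eq_def
proof
  fix x assume x: "x \<in> c00"
  note xw = c00_wspace[OF x]
  define S where "S = {\<Sum>j<k. wmod TK 1 (restr (E j) x) | k E. admissible k E}"
  have S_eq: "{\<Sum>j<k. if restr (E j) x \<in> c00 then wmod TK 1 (restr (E j) x) else 0 | k E. admissible k E} = S"
    using c00_restr[OF x] by (simp add: S_def)
  have le: "s \<le> 2 * wmod TK 1 x" if "s \<in> S" for s
    using that TK.wmod_admissible_le[OF _ xw] by (fastforce simp: S_def)
  have ne: "S \<noteq> {}" unfolding S_def using ex_admissible by blast
  have bdd: "bdd_above S" using le by (rule bdd_aboveI)
  have "wmod TK 1 x = max (supnorm0 x) (1/2 * Sup S)"
  proof (rule antisym)
    show "max (supnorm0 x) (1/2 * Sup S) \<le> wmod TK 1 x"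
    proof (rule max.boundedI)
      show "supnorm0 x \<le> wmod TK 1 x"
        unfolding supnorm0_def
        using TK.abs_coord_le_wnorm[OF _ xw, of 1] wnorm_one_eq_wmod[OF xw] by (intro cSUP_least) auto
      show "1/2 * Sup S \<le> wmod TK 1 x"
        using cSup_least[OF ne le] by simp
    qed
    show "wmod TK 1 x \<le> max (supnorm0 x) (1/2 * Sup S)"
    proof (rule TK.wmod_least)
      fix \<phi> M assume "\<phi> \<in> TK"
      then show "wsum \<phi> 1 M x \<le> max (supnorm0 x) (1/2 * Sup S)"
      proof cases
        case (TK_unit i)
        have "\<bar>x i\<bar> \<le> supnorm0 x"
          unfolding supnorm0_def by (rule cSUP_upper[OF _ c00_bdd_above_abs[OF x]]) simp
        moreover have "wsum \<phi> 1 M x \<le> \<bar>x i\<bar>"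
        proof -
          have "wsum \<phi> 1 M x = (\<Sum>j<M. if j = i then \<bar>x i\<bar> else 0)"
            unfolding wsum_def TK_unit by (intro sum.cong) (auto simp: indicator_def)
          then show ?thesis by simp
        qed
        ultimately show ?thesis by simp
      next
        case (TK_admissible k E \<phi>s)
        have "wsum \<phi> 1 M x = (\<Sum>i<M. \<Sum>j<k. (1/2) * ((if i \<in> E j then \<phi>s j i else 0) * \<bar>x i\<bar> powr 1))"
          unfolding wsum_def TK_admissible(1) by (simp add: sum_distrib_left sum_distrib_right mult.assoc)
        also have "\<dots> = 1/2 * (\<Sum>j<k. wsum (\<phi>s j) 1 M (restr (E j) x))"
          by (subst sum.swap) (simp add: TK.wsum_restr sum_distrib_left)
        also have "\<dots> \<le> 1/2 * (\<Sum>j<k. wmod TK 1 (restr (E j) x))"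
          using TK_admissible(3)
          by (intro mult_left_mono sum_mono TK.wsum_le_wmod c00_wspace c00_restr x) auto
        also have "\<dots> \<le> 1/2 * Sup S"
          using TK_admissible(2) by (intro mult_left_mono cSup_upper bdd) (auto simp: S_def)
        finally show ?thesis by simp
      qed
    qed
  qed
  then show "(if x \<in> c00 then wmod TK 1 x else 0) = max (supnorm0 x)
      (1/2 * Sup {\<Sum>j<k. if restr (E j) x \<in> c00 then wmod TK 1 (restr (E j) x) else 0 | k E. admissible k E})"
    unfolding S_eq using x by simp
qed

section \<open>Uniqueness of the Tsirelson norm\<close>

lemma norm_c00_restr_le:
  assumes f: "is_norm_on_c00 f" and "finite A"
  shows "f (restr A x) \<le> (\<Sum>i\<in>A. \<bar>x i\<bar> * f (indicator {i}))"
  using assms(2)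
proof (induction A rule: finite_induct)
  case empty
  have "restr {} x = (\<lambda>_. 0)" by (simp add: restr_def)
  moreover have "(\<lambda>_. 0) \<in> c00" by (simp add: c00_def)
  ultimately show ?case using f by (auto simp: is_norm_on_c00_def)
next
  case (insert a A)
  have i: "indicator {a} \<in> c00" by (simp add: c00_def indicator_def)
  have ia: "(\<lambda>i. x a * indicator {a} i) \<in> c00"
    by (auto simp: c00_def indicator_def intro: finite_subset[of _ "{a}"])
  have r: "restr A x \<in> c00"
    using insert by (auto simp: c00_def restr_def intro: finite_subset[of _ A])
  have "restr (insert a A) x = (\<lambda>i. x a * indicator {a} i + restr A x i)"
    using insert by (auto simp: restr_def indicator_def)
  then have "f (restr (insert a A) x) \<le> f (\<lambda>i. x a * indicator {a} i) + f (restr A x)"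
    using f ia r by (simp add: is_norm_on_c00_def)
  also have "f (\<lambda>i. x a * indicator {a} i) = \<bar>x a\<bar> * f (indicator {a})"
    using f i by (simp add: is_norm_on_c00_def)
  finally show ?case using insert by simp
qed

text \<open>Supplies the boundedness without which the supremum in \<open>tsirelson_eq\<close> could
  not be used for an arbitrary norm on \<open>c00\<close>.\<close>

lemma admissible_sum_le:
  assumes f: "is_norm_on_c00 f" and x: "x \<in> c00" and E: "admissible k E"
  shows "(\<Sum>j<k. f (restr (E j) x)) \<le> (\<Sum>i | x i \<noteq> 0. \<bar>x i\<bar> * f (indicator {i}))"
proof -
  have f0: "0 \<le> f (indicator {i})" for i
    using f by (simp add: is_norm_on_c00_def c00_def indicator_def)
  have fin: "finite (E j)" if "j < k" for j using E that by (simp add: admissible_def)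
  have "(\<Sum>j<k. f (restr (E j) x)) \<le> (\<Sum>j<k. \<Sum>i\<in>E j. \<bar>x i\<bar> * f (indicator {i}))"
    using fin by (intro sum_mono norm_c00_restr_le[OF f]) auto
  also have "\<dots> = (\<Sum>i\<in>(\<Union>j<k. E j). \<bar>x i\<bar> * f (indicator {i}))"
    using fin admissible_disjoint[OF E] by (intro sum.UNION_disjoint[symmetric]) auto
  also have "\<dots> = (\<Sum>i\<in>(\<Union>j<k. E j) \<inter> {i. x i \<noteq> 0}. \<bar>x i\<bar> * f (indicator {i}))"
    using fin by (intro sum.mono_neutral_right) auto
  also have "\<dots> \<le> (\<Sum>i | x i \<noteq> 0. \<bar>x i\<bar> * f (indicator {i}))"
    using x f0 by (intro sum_mono2) (auto simp: c00_def)
  finally show ?thesis .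
qed

text \<open>Induction on the size of the support. In an admissible family either one set contains
  the whole support and the sum is \<open>f x\<close>, or every restriction has smaller support and
  the induction hypothesis applies. Halving turns the first case into \<open>f x / 2\<close>, which
  cannot account for \<open>f x > g x\<close>.\<close>

lemma tsirelson_eq_le:
  assumes f: "is_norm_on_c00 f" "tsirelson_eq f" and g: "is_norm_on_c00 g" "tsirelson_eq g"
  shows "x \<in> c00 \<Longrightarrow> f x \<le> g x"
proof (induction "card {i. x i \<noteq> 0}" arbitrary: x rule: less_induct)
  case less
  let ?S = "\<lambda>h :: (nat \<Rightarrow> real) \<Rightarrow> real. {\<Sum>j<k. h (restr (E j) x) | k E. admissible k E}"
  have fx: "f x = max (supnorm0 x) ((1/2) * Sup (?S f))" and gx: "g x = max (supnorm0 x) ((1/2) * Sup (?S g))"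
    using f(2) g(2) less.prems unfolding tsirelson_eq_def by blast+
  have f0: "0 \<le> f x" and g0: "0 \<le> g x"
    using f(1) g(1) less.prems by (simp_all add: is_norm_on_c00_def)
  have bdd: "bdd_above (?S g)"
    using admissible_sum_le[OF g(1) less.prems] by (auto intro!: bdd_aboveI)
  have "Sup (?S f) \<le> max (f x) (2 * g x)"
  proof (rule cSup_least)
    show "?S f \<noteq> {}" using ex_admissible by blast
    fix s assume "s \<in> ?S f"
    then obtain k E where kE: "s = (\<Sum>j<k. f (restr (E j) x))" "admissible k E" by blast
    show "s \<le> max (f x) (2 * g x)"
    proof (cases "\<exists>j<k. {i. x i \<noteq> 0} \<subseteq> E j")
      case True
      then obtain j where j: "j < k" "{i. x i \<noteq> 0} \<subseteq> E j" by blast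
      have "f (restr (E i) x) = (if i = j then f x else 0)" if "i < k" for i
      proof (cases "i = j")
        case True
        have "restr (E j) x = x" using j by (intro ext) (auto simp: restr_def)
        then show ?thesis using True by simp
      next
        case False
        have "x a = 0" if "a \<in> E i" for a
          using admissible_disjoint[OF kE(2) \<open>i < k\<close> j(1) that] j(2) False by blast
        then have "restr (E i) x = (\<lambda>_. 0)" by (auto simp: restr_def)
        moreover have "(\<lambda>_. 0) \<in> c00" by (simp add: c00_def)
        ultimately show ?thesis using f(1) False by (auto simp: is_norm_on_c00_def)
      qed
      then have "s = (\<Sum>i<k. if i = j then f x else 0)" unfolding kE(1) by (intro sum.cong) auto
      then show ?thesis using j by simp
    next
      case False
      have "f (restr (E j) x) \<le> g (restr (E j) x)" if "j < k" for j
      proof (rule less.hyps)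
        show "restr (E j) x \<in> c00" by (rule c00_restr[OF less.prems])
        have "{i. restr (E j) x i \<noteq> 0} \<subset> {i. x i \<noteq> 0}"
          using False that by (auto simp: restr_def)
        then show "card {i. restr (E j) x i \<noteq> 0} < card {i. x i \<noteq> 0}"
          using less.prems by (intro psubset_card_mono) (auto simp: c00_def)
      qed
      then have "s \<le> (\<Sum>j<k. g (restr (E j) x))" unfolding kE(1) by (intro sum_mono) auto
      also have "\<dots> \<le> Sup (?S g)" using kE(2) by (intro cSup_upper bdd) auto
      also have "\<dots> \<le> 2 * g x" using gx by simp
      finally show ?thesis by simp
    qed
  qed
  moreover have "supnorm0 x \<le> g x" using gx by simp
  ultimately show ?case using fx f0 g0 by (auto simp: max_def split: if_splits)
qed

lemma tsirelson_norm_eq_wmod: "tsirelson_norm = (\<lambda>x. if x \<in> c00 then wmod TK 1 x else 0)"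
  unfolding tsirelson_norm_def
proof (rule the_equality)
  let ?t = "\<lambda>x. if x \<in> c00 then wmod TK 1 x else 0"
  show "is_norm_on_c00 ?t \<and> tsirelson_eq ?t \<and> (\<forall>x. x \<notin> c00 \<longrightarrow> ?t x = 0)"
    using is_norm_on_c00_wmod tsirelson_eq_wmod by auto
  fix f assume f: "is_norm_on_c00 f \<and> tsirelson_eq f \<and> (\<forall>x. x \<notin> c00 \<longrightarrow> f x = 0)"
  show "f = ?t"
  proof
    fix x
    show "f x = ?t x"
    proof (cases "x \<in> c00")
      case True
      then show ?thesis
        using tsirelson_eq_le[OF _ _ is_norm_on_c00_wmod tsirelson_eq_wmod True, of f]
          tsirelson_eq_le[OF is_norm_on_c00_wmod tsirelson_eq_wmod _ _ True, of f] f
        by (auto intro: antisym)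
    qed (use f in simp)
  qed
qed

section \<open>The completion and its convexifications as weighted spaces\<close>

lemma trunc_c00: "trunc m x \<in> c00"
  by (auto simp: c00_def trunc_def restr_def intro: finite_subset[of _ "{..<m}"])

lemma trunc_diff_c00: "(\<lambda>i. trunc n x i - trunc m x i) \<in> c00"
  by (auto simp: c00_def trunc_def restr_def intro: finite_subset[of _ "{..<max m n}"])

text \<open>Small tails make the truncations Cauchy. Conversely, late truncations lie within 1 of
  \<open>trunc N x\<close>, which bounds every finite sum.\<close>

lemma T_space_eq: "T_space = wspace TK 1"
proof (intro set_eqI iffI)
  fix x assume x: "x \<in> wspace TK 1"
  show "x \<in> T_space"
    unfolding T_space_def mem_Collect_eq
  proof (intro allI impI)
    fix e :: real assume e: "0 < e"
    then obtain N where N: "wmod TK 1 (restr {N..} x) \<le> e / 2"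
      using TK.wmod_tail_small[OF _ x, of "e / 2"] by auto
    have "tsirelson_norm (\<lambda>i. trunc n x i - trunc m x i) < e" if "N \<le> m" "N \<le> n" for m n
    proof -
      have "wmod TK 1 (\<lambda>i. trunc n x i - trunc m x i) \<le> wmod TK 1 (restr {N..} x)"
        using that by (intro TK.wmod_mono TK.wspace_restr x) (auto simp: trunc_def restr_def)
      then show ?thesis using N e trunc_diff_c00[of n x m] by (simp add: tsirelson_norm_eq_wmod)
    qed
    then show "\<exists>N. \<forall>m\<ge>N. \<forall>n\<ge>N. tsirelson_norm (\<lambda>i. trunc n x i - trunc m x i) < e" by blast
  qed
next
  fix x assume "x \<in> T_space"
  then obtain N where N: "\<forall>m\<ge>N. \<forall>n\<ge>N. tsirelson_norm (\<lambda>i. trunc n x i - trunc m x i) < 1"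
    unfolding T_space_def using zero_less_one by blast
  show "x \<in> wspace TK 1"
  proof (rule TK.wspaceI)
    fix \<phi> M assume \<phi>: "\<phi> \<in> TK"
    define n where "n = max M N"
    have "wmod TK 1 (\<lambda>i. trunc n x i - trunc N x i) < 1"
      using N[rule_format, of N n] trunc_diff_c00[of n x N] by (simp add: n_def tsirelson_norm_eq_wmod)
    moreover have "wnorm TK 1 (trunc n x) \<le> wnorm TK 1 (\<lambda>i. trunc n x i - trunc N x i) + wnorm TK 1 (trunc N x)"
      using TK.wnorm_triangle[OF _ c00_wspace[OF trunc_diff_c00[of n x N]] c00_wspace[OF trunc_c00[of N x]]] by simp
    ultimately have "wmod TK 1 (trunc n x) \<le> 1 + wmod TK 1 (trunc N x)"
      using c00_wspace[OF trunc_diff_c00[of n x N]] c00_wspace[OF trunc_c00] by (simp add: wnorm_one_eq_wmod)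
    moreover have "wsum \<phi> 1 M x = wsum \<phi> 1 M (trunc n x)"
      unfolding wsum_def by (intro sum.cong) (auto simp: trunc_def restr_def n_def)
    ultimately show "wsum \<phi> 1 M x \<le> 1 + wmod TK 1 (trunc N x)"
      using TK.wsum_le_wmod[OF c00_wspace[OF trunc_c00] \<phi>, of 1 M n x] by simp
  qed
qed

text \<open>The moduli of the truncations stay below that of \<open>x\<close> and eventually exceed
  every smaller number.\<close>

lemma T_norm_eq:
  assumes x: "x \<in> wspace TK 1"
  shows "T_norm x = wmod TK 1 x"
proof -
  have "(\<lambda>m. wmod TK 1 (trunc m x)) \<longlonglongrightarrow> wmod TK 1 x"
  proof (rule order_tendstoI)
    fix a assume "a < wmod TK 1 x"
    then have "\<exists>M. \<forall>N\<ge>M. a < wmod TK 1 (restr (UNIV \<inter> {..<N}) x)"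
      by (intro TK.wmod_restr_finite_approx x) (simp_all add: restr_def)
    then show "\<forall>\<^sub>F m in sequentially. a < wmod TK 1 (trunc m x)"
      by (simp add: eventually_sequentially trunc_def)
  next
    fix a assume "wmod TK 1 x < a"
    moreover have "wmod TK 1 (trunc m x) \<le> wmod TK 1 x" for m
      by (intro TK.wmod_mono x) (auto simp: trunc_def restr_def)
    ultimately show "\<forall>\<^sub>F m in sequentially. wmod TK 1 (trunc m x) < a"
      by (auto intro!: always_eventually intro: le_less_trans)
  qed
  then show ?thesis
    unfolding T_norm_def by (simp add: tsirelson_norm_eq_wmod trunc_c00 limI)
qed

lemma wsum_abs_powr: "wsum \<phi> 1 M (\<lambda>i. \<bar>x i\<bar> powr p) = wsum \<phi> p M x"
  by (simp add: wsum_def)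

lemma Tp_eq: "Tp p = wspace TK p"
  by (simp add: Tp_def T_space_eq wspace_def wsum_abs_powr)

lemma Tp_dist_eq:
  assumes "1 \<le> p" "x \<in> wspace TK p" "y \<in> wspace TK p"
  shows "Tp_dist p x y = wdist TK p x y"
proof -
  have "(\<lambda>i. x i - y i) \<in> Tp p" unfolding Tp_eq by (rule TK.wspace_diff[OF assms])
  then have "T_norm (\<lambda>i. \<bar>x i - y i\<bar> powr p) = wmod TK 1 (\<lambda>i. \<bar>x i - y i\<bar> powr p)"
    by (intro T_norm_eq) (simp add: Tp_def T_space_eq)
  then show ?thesis
    by (simp add: Tp_dist_def Tp_norm_def wdist_def wnorm_def wmod_def wsum_abs_powr)
qed

section \<open>The spaces \<open>\<ell>\<^sub>p\<close>\<close>

interpretation l1: tsirelson_weights "{\<lambda>_. 1}"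
proof
  fix k E and \<phi>s :: "nat \<Rightarrow> nat \<Rightarrow> real"
  assume E: "admissible k E" and \<phi>: "\<And>j. j < k \<Longrightarrow> \<phi>s j \<in> {\<lambda>_. 1}"
  have "(1/2) * (\<Sum>j<k. if i \<in> E j then \<phi>s j i else 0) \<le> 1" for i
  proof (cases "\<exists>j<k. i \<in> E j")
    case True
    then obtain j where "j < k" "i \<in> E j" by blast
    then show ?thesis using admissible_sum_single[OF E, of j i "\<lambda>j. \<phi>s j i"] \<phi>[of j] by simp
  next
    case False
    then have "(\<Sum>j<k. if i \<in> E j then \<phi>s j i else 0) = 0" by (intro sum.neutral) auto
    then show ?thesis by simp
  qed
  then show "\<exists>\<psi>\<in>{\<lambda>_. 1}. \<forall>i. (1/2) * (\<Sum>j<k. if i \<in> E j then \<phi>s j i else 0) \<le> \<psi> i" by simp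
qed auto

lemma lp_eq: "lp p = wspace {\<lambda>_. 1} p"
proof (intro set_eqI iffI)
  fix x assume "x \<in> lp p"
  then show "x \<in> wspace {\<lambda>_. 1} p"
    by (intro l1.wspaceI[where A = "\<Sum>i. \<bar>x i\<bar> powr p"]) (auto simp: lp_def wsum_def intro!: sum_le_suminf)
next
  fix x assume "x \<in> wspace {\<lambda>_. 1} p"
  then obtain A where "\<And>M. (\<Sum>i<M. \<bar>x i\<bar> powr p) \<le> A" by (auto simp: wspace_def wsum_def)
  then show "x \<in> lp p"
    unfolding lp_def mem_Collect_eq by (intro summableI_nonneg_bounded[where x = A]) auto
qed

lemma lp_dist_eq:
  assumes "1 \<le> p" "x \<in> lp p" "y \<in> lp p"
  shows "lp_dist p x y = wdist {\<lambda>_. 1} p x y"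
proof -
  let ?z = "\<lambda>i. x i - y i"
  have z: "?z \<in> lp p" using assms unfolding lp_eq by (intro l1.wspace_diff)
  then have sm: "summable (\<lambda>i. \<bar>x i - y i\<bar> powr p)" by (simp add: lp_def)
  have "wmod {\<lambda>_. 1} p ?z = (\<Sum>i. \<bar>x i - y i\<bar> powr p)"
  proof (rule antisym)
    show "wmod {\<lambda>_. 1} p ?z \<le> (\<Sum>i. \<bar>x i - y i\<bar> powr p)"
      by (rule l1.wmod_least) (auto simp: wsum_def intro!: sum_le_suminf sm)
    show "(\<Sum>i. \<bar>x i - y i\<bar> powr p) \<le> wmod {\<lambda>_. 1} p ?z"
      using l1.wsum_le_wmod[of ?z p "\<lambda>_. 1"] z by (intro suminf_le_const sm) (simp add: wsum_def lp_eq)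
  qed
  then show ?thesis by (simp add: lp_dist_def wdist_def wnorm_def)
qed

text \<open>Transfers the result to the given definitions: the free parameter \<open>t\<close> is
  instantiated with the distance of the two points.\<close>

lemma not_coarse_lipschitz_embeds_dsum:
  assumes D: "tsirelson_weights K0" and p: "1 \<le> p"
    and ps: "\<And>i. i < n \<Longrightarrow> 1 \<le> ps i" "\<And>i. i < n \<Longrightarrow> ps i \<noteq> p"
    and A: "A = wspace K0 p" and dA: "\<And>x y. x \<in> A \<Longrightarrow> y \<in> A \<Longrightarrow> dA x y = wdist K0 p x y"
  shows "\<not> coarse_lipschitz_embeds A dA (dsum n ps) (dsum_dist n ps)"
proof
  interpret D: tsirelson_weights K0 by fact
  assume "coarse_lipschitz_embeds A dA (dsum n ps) (dsum_dist n ps)"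
  then obtain f L where fA: "f ` A \<subseteq> dsum n ps" and L: "0 < L"
    and up: "\<forall>t\<ge>0. \<forall>x\<in>A. \<forall>y\<in>A. dA x y \<le> t \<longrightarrow> dsum_dist n ps (f x) (f y) \<le> L * t + L"
    and lo: "\<forall>t\<ge>0. \<forall>x\<in>A. \<forall>y\<in>A. dA x y \<ge> t \<longrightarrow> dsum_dist n ps (f x) (f y) \<ge> t / L - L"
    unfolding coarse_lipschitz_embeds_def by blast
  have f: "f x i \<in> wspace TK (ps i)" if "x \<in> A" "i < n" for x i
    using fA that by (auto simp: dsum_def Tp_eq)
  have dist: "dsum_dist n ps (f x) (f y) = (\<Sum>i<n. wdist TK (ps i) (f x i) (f y i))" if "x \<in> A" "y \<in> A" for x y
    unfolding dsum_dist_def using f that ps(1) by (intro sum.cong) (auto simp: Tp_dist_eq)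
  show False
  proof (rule no_coarse_lipschitz_map[OF D TK.tsirelson_weights_axioms p ps _ L])
    fix x y assume xy: "x \<in> wspace K0 p" "y \<in> wspace K0 p"
    show "(\<Sum>i<n. wdist TK (ps i) (f x i) (f y i)) \<le> L * wdist K0 p x y + L"
      using up[rule_format, of "wdist K0 p x y" x y] dist[of x y] dA[of x y] xy by (simp add: A wdist_def)
    show "wdist K0 p x y / L - L \<le> (\<Sum>i<n. wdist TK (ps i) (f x i) (f y i))"
      using lo[rule_format, of "wdist K0 p x y" x y] dist[of x y] dA[of x y] xy by (simp add: A wdist_def)
  qed (use f A in auto)
qed

theorem theorem1p3:
  fixes n :: nat and ps :: "nat \<Rightarrow> real" and p :: real
  assumes "1 \<le> n"
    and "1 \<le> ps 0"
    and "\<forall>i. Suc i < n \<longrightarrow> ps i < ps (Suc i)"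
    and "1 \<le> p"
    and "\<forall>i<n. p \<noteq> ps i"
  shows "\<not> coarse_lipschitz_embeds (Tp p) (Tp_dist p) (dsum n ps) (dsum_dist n ps)
       \<and> \<not> coarse_lipschitz_embeds (lp p) (lp_dist p) (dsum n ps) (dsum_dist n ps)
       \<and> (\<forall>p' q :: real. 1 \<le> p' \<and> 1 \<le> q \<and> p' \<noteq> q \<longrightarrow>
            \<not> coarse_lipschitz_embeds (Tp p') (Tp_dist p') (Tp q) (Tp_dist q))"
proof (intro conjI allI impI)
  have ge: "1 \<le> ps i" if "i < n" for i
    using that
  proof (induction i)
    case (Suc i)
    then have "1 \<le> ps i" "ps i < ps (Suc i)" using assms(3) by auto
    then show ?case by simp
  qed (use assms in simp)
  have ne: "ps i \<noteq> p" if "i < n" for i using assms(5) that by auto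
  show "\<not> coarse_lipschitz_embeds (Tp p) (Tp_dist p) (dsum n ps) (dsum_dist n ps)"
    by (rule not_coarse_lipschitz_embeds_dsum[OF TK.tsirelson_weights_axioms assms(4) ge ne Tp_eq])
      (use assms(4) in \<open>auto simp: Tp_eq Tp_dist_eq\<close>)
  show "\<not> coarse_lipschitz_embeds (lp p) (lp_dist p) (dsum n ps) (dsum_dist n ps)"
    by (rule not_coarse_lipschitz_embeds_dsum[OF l1.tsirelson_weights_axioms assms(4) ge ne lp_eq])
      (use assms(4) in \<open>auto simp: lp_dist_eq\<close>)
  fix p' q :: real assume pq: "1 \<le> p' \<and> 1 \<le> q \<and> p' \<noteq> q"
  have no: "\<not> coarse_lipschitz_embeds (Tp p') (Tp_dist p') (dsum 1 (\<lambda>_. q)) (dsum_dist 1 (\<lambda>_. q))"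
    by (rule not_coarse_lipschitz_embeds_dsum[OF TK.tsirelson_weights_axioms _ _ _ Tp_eq])
      (use pq in \<open>auto simp: Tp_eq Tp_dist_eq\<close>)
  show "\<not> coarse_lipschitz_embeds (Tp p') (Tp_dist p') (Tp q) (Tp_dist q)"
  proof
    assume "coarse_lipschitz_embeds (Tp p') (Tp_dist p') (Tp q) (Tp_dist q)"
    then obtain f L where f: "f ` Tp p' \<subseteq> Tp q" "0 < L"
      "\<forall>t\<ge>0. \<forall>x\<in>Tp p'. \<forall>y\<in>Tp p'. Tp_dist p' x y \<le> t \<longrightarrow> Tp_dist q (f x) (f y) \<le> L * t + L"
      "\<forall>t\<ge>0. \<forall>x\<in>Tp p'. \<forall>y\<in>Tp p'. Tp_dist p' x y \<ge> t \<longrightarrow> Tp_dist q (f x) (f y) \<ge> t / L - L"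
      unfolding coarse_lipschitz_embeds_def by blast
    \<comment> \<open>A single space is treated as a sum with one term: \<open>f\<close> becomes
      component 0, and the other components are zero as \<open>dsum\<close> prescribes.\<close>
    define F where "F = (\<lambda>x (i::nat). if i = 0 then f x else (\<lambda>_. 0))"
    have "F ` Tp p' \<subseteq> dsum 1 (\<lambda>_. q)" using f(1) by (auto simp: dsum_def F_def)
    moreover have "dsum_dist 1 (\<lambda>_. q) (F x) (F y) = Tp_dist q (f x) (f y)" for x y
      by (simp add: dsum_dist_def F_def)
    ultimately have "coarse_lipschitz_embeds (Tp p') (Tp_dist p') (dsum 1 (\<lambda>_. q)) (dsum_dist 1 (\<lambda>_. q))"
      unfolding coarse_lipschitz_embeds_def using f(2-4) by (intro exI[of _ F] exI[of _ L]) simp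
    then show False using no by blast
  qed
qed

end
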